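(* Let $s_2 \ge s_1 \ge 2$ be integers, let $s := s_1+s_2$, and let $\mathbb{B}$ be a connected $s_1$ by $s_2$ bipartite graph with covering number $\tau(\mathbb{B}) = s_1$. Then there is $n_0$ such that for every $n \ge n_0$, $$\mathrm{ex}\left(n,(t+1)\mathbb{B}\right) = \binom{n}{2} - \binom{n-s_1(t+1)+1}{2} + \mathrm{ex}\left(n-s_1(t+1)+1,\ \mathbb{B}[s_2+1]\right)$$ holds for all integers $t$ satisfying $$\max\left\{\sqrt{32 s_1 s n},\ \frac{12800 e s^5}{s_1}\left(\frac{\mathrm{ex}(n,\mathbb{B})}{n-1} + 576 e s_1 s^2\right)\right\} \le t \le \frac{n}{1024 e s_1 s^3}.$$
   Context: An $s_1$ by $s_2$ bipartite graph is a graph whose vertex set is partitioned into $W_1,W_2$ with $|W_1|=s_1$, $|W_2|=s_2$ such that every edge joins $W_1$ and $W_2$. The covering number $\tau(F)$ is the minimum size of a set of vertices meeting every edge of $F$. For a graph $F$ and integer $k$, $F[k]$ denotes the family $\{F[S] : S\subseteq V(F),\ |S|=k\}$ of induced subgraphs of $F$ on $k$ vertices. For a family $\mathcal{F}$, $\mathrm{ex}(n,\mathcal{F})$ is the maximum number of edges of an $n$-vertex graph containing no member of $\mathcal{F}$ as a subgraph; $\mathrm{ex}(n,F)=\mathrm{ex}(n,\{F\})$; and $\mathrm{ex}(n,(t+1)F)$ is the maximum number of edges of an $n$-vertex graph not containing $t+1$ pairwise vertex-disjoint copies of $F$. $e$ is Euler's number. *)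

theory Defs
  imports Complex_Main
begin

definition is_graph :: "'a set \<times> 'a set set \<Rightarrow> bool" where
  "is_graph G \<longleftrightarrow> finite (fst G) \<and>
     (\<forall>e\<in>snd G. card e = 2 \<and> e \<subseteq> fst G)"

definition bipartite_by :: "'a set \<times> 'a set set \<Rightarrow> nat \<Rightarrow> nat \<Rightarrow> bool" where
  "bipartite_by G s1 s2 \<longleftrightarrow> (\<exists>W1 W2. W1 \<inter> W2 = {} \<and> W1 \<union> W2 = fst G \<and>
     card W1 = s1 \<and> card W2 = s2 \<and> (\<forall>e\<in>snd G. e \<inter> W1 \<noteq> {} \<and> e \<inter> W2 \<noteq> {}))"

definition graph_connected :: "'a set \<times> 'a set set \<Rightarrow> bool" where
  "graph_connected G \<longleftrightarrow>
     (\<forall>u\<in>fst G. \<forall>v\<in>fst G. (\<lambda>x y. {x, y} \<in> snd G)\<^sup>*\<^sup>* u v)"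

definition cover_number :: "'a set \<times> 'a set set \<Rightarrow> nat" where
  "cover_number G = (LEAST k. \<exists>C. C \<subseteq> fst G \<and> card C = k \<and> (\<forall>e\<in>snd G. e \<inter> C \<noteq> {}))"

definition induced_family :: "'a set \<times> 'a set set \<Rightarrow> nat \<Rightarrow> ('a set \<times> 'a set set) set" where
  "induced_family F k = {(S, {e\<in>snd F. e \<subseteq> S}) | S. S \<subseteq> fst F \<and> card S = k}"

definition embedding :: "('a \<Rightarrow> 'b) \<Rightarrow> 'a set \<times> 'a set set \<Rightarrow> 'b set \<times> 'b set set \<Rightarrow> bool" where
  "embedding f H G \<longleftrightarrow> inj_on f (fst H) \<and> f ` fst H \<subseteq> fst G \<and> (\<forall>e\<in>snd H. f ` e \<in> snd G)"

definition contains_copy :: "'b set \<times> 'b set set \<Rightarrow> 'a set \<times> 'a set set \<Rightarrow> bool" where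
  "contains_copy G H \<longleftrightarrow> (\<exists>f. embedding f H G)"

definition contains_disjoint_copies :: "'b set \<times> 'b set set \<Rightarrow> nat \<Rightarrow> 'a set \<times> 'a set set \<Rightarrow> bool" where
  "contains_disjoint_copies G m H \<longleftrightarrow>
     (\<exists>f :: nat \<Rightarrow> 'a \<Rightarrow> 'b. (\<forall>i<m. embedding (f i) H G) \<and>
        (\<forall>i<m. \<forall>j<m. i \<noteq> j \<longrightarrow> f i ` fst H \<inter> f j ` fst H = {}))"

definition ex_prop :: "nat \<Rightarrow> (nat set \<times> nat set set \<Rightarrow> bool) \<Rightarrow> nat" where
  "ex_prop n P = Max {card E | E. is_graph ({0..<n}, E) \<and> P ({0..<n}, E)}"

definition ex_family :: "nat \<Rightarrow> ('a set \<times> 'a set set) set \<Rightarrow> nat" where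
  "ex_family n \<F> = ex_prop n (\<lambda>G. \<forall>H\<in>\<F>. \<not> contains_copy G H)"

definition ex_graph :: "nat \<Rightarrow> 'a set \<times> 'a set set \<Rightarrow> nat" where
  "ex_graph n F = ex_family n {F}"

definition ex_disjoint :: "nat \<Rightarrow> nat \<Rightarrow> 'a set \<times> 'a set set \<Rightarrow> nat" where
  "ex_disjoint n m F = ex_prop n (\<lambda>G. \<not> contains_disjoint_copies G m F)"

end

theory Submission
  imports Defs
begin

text \<open>
  Lower bound: join a clique on s1 (t + 1) - 1 vertices with an extremal graph for the family of
  induced subgraphs of B on s2 + 1 vertices. Among t + 1 disjoint copies of B one meets the clique
  in fewer than s1 vertices, which leaves a forbidden graph outside.

  Upper bound: in a graph G with at least that many edges let L be the set of vertices of
  linear degree. Vertices of L can be grouped into copies of the complete bipartite graph with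
  parts s1 and s2, while G - L contributes few edges unless it has many disjoint copies of B;
  hence L has about s1 t vertices, and almost all of them are adjacent to almost everything.
  Let x be the number of vertices that L lacks from s1 (t + 1) - 1. If G - L had x + 1 disjoint
  stars with s2 leaves, each could be completed to a copy of B by s1 - 1 vertices of L, the rest
  of L would be grouped as before, and t + 1 disjoint copies of B would appear. So, up to x bounded
  pieces, G - L has bounded degree and L misses only O(n) pairs. As t^2 exceeds a
  large multiple of n, L is then so dense that also forbidden graphs in G - L can be completed to
  copies of B by cliques of L. Thus G - L becomes free of the family after deleting x bounded pieces of
  small degree, and the edges lost at these pieces are fewer than those gained by x further
  vertices of full degree.
\<close>

section \<open>Packings of copies\<close>

text \<open>The balance behind the constants: a vertex outside L has degree below n / (16 s), so
  deleting s such vertices costs at most n / 16 edges, whereas each vertex that L falls short of its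
  expected size costs the graph about 3 n / 4 edges or more. Boundedly many deletions per lacking
  vertex are therefore always paid for. Two obstacles shape the upper bound. Grouping L by
  pigeonhole wastes up to C vertices, while an exact formula tolerates no waste. So the non-edges at
  L are first bounded by a small multiple of t n, which makes all but t / 100 vertices of L nearly
  full, and only then L can be used up exactly. Next, cliques in L require O(n) non-edges at L, and
  this bound has to come before any clique is available. Stars break the circle: the vertices of L
  that complete them all lie on one side of a complete bipartite graph, so no edge inside L is
  needed.\<close>

definition hosts :: "'b set \<times> 'b set set \<Rightarrow> 'a set \<times> 'a set set \<Rightarrow> 'b set \<Rightarrow> bool" where
  "hosts G H S \<longleftrightarrow> (\<exists>f. embedding f H G \<and> f ` fst H = S)"

definition packing :: "('b set \<Rightarrow> bool) \<Rightarrow> 'b set set \<Rightarrow> bool" where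
  "packing Q \<S> \<longleftrightarrow> finite \<S> \<and> (\<forall>S\<in>\<S>. Q S) \<and> pairwise disjnt \<S>"

lemma packing_empty [simp]: "packing Q {}"
  by (simp add: packing_def)

lemma packing_mono: "packing Q \<S> \<Longrightarrow> (\<And>S. Q S \<Longrightarrow> Q' S) \<Longrightarrow> packing Q' \<S>"
  by (auto simp: packing_def)

lemma packing_insert:
  assumes "packing Q \<S>" "Q T" "T \<inter> \<Union>\<S> = {}" "T \<noteq> {}"
  shows "packing Q (insert T \<S>)" "card (insert T \<S>) = Suc (card \<S>)"
proof -
  have "T \<notin> \<S>" using assms by blast
  then show "card (insert T \<S>) = Suc (card \<S>)"
    using assms by (simp add: packing_def)
  show "packing Q (insert T \<S>)"
    using assms by (auto simp: packing_def pairwise_insert disjnt_def)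
qed

lemma packing_Un:
  assumes "packing Q \<S>" "packing Q \<T>" "\<Union>\<S> \<inter> \<Union>\<T> = {}" "\<And>S. Q S \<Longrightarrow> S \<noteq> {}"
  shows "packing Q (\<S> \<union> \<T>)" "card (\<S> \<union> \<T>) = card \<S> + card \<T>"
proof -
  have "\<S> \<inter> \<T> = {}"
    using assms unfolding packing_def by fast
  then show "card (\<S> \<union> \<T>) = card \<S> + card \<T>"
    using assms by (simp add: packing_def card_Un_disjoint)
  have "disjnt S T" if "S \<in> \<S>" "T \<in> \<T>" for S T
    using assms(3) that unfolding disjnt_def by blast
  then show "packing Q (\<S> \<union> \<T>)"
    using assms(1,2) unfolding packing_def pairwise_def by (auto simp: disjnt_sym)
qed

text \<open>A packing that is not maximal can be enlarged by one set. The second alternative is used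
  to obtain a small vertex set meeting every instance of \<open>Q\<close>, which can then be
  deleted.\<close>

lemma packing_or_maximal:
  assumes ne: "\<And>S. Q S \<Longrightarrow> S \<noteq> {}"
  shows "(\<exists>\<S>. packing Q \<S> \<and> card \<S> = k) \<or>
    (\<exists>\<S>. packing Q \<S> \<and> card \<S> < k \<and> (\<forall>S. Q S \<longrightarrow> S \<inter> \<Union>\<S> \<noteq> {}))"
proof (induction k)
  case 0
  have "packing Q {} \<and> card {} = 0" by simp
  then show ?case by blast
next
  case (Suc k)
  then show ?case
  proof
    assume "\<exists>\<S>. packing Q \<S> \<and> card \<S> = k"
    then obtain \<S> where S: "packing Q \<S>" "card \<S> = k" by blast
    show ?thesis
    proof (cases "\<forall>S. Q S \<longrightarrow> S \<inter> \<Union>\<S> \<noteq> {}")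
      case True
      then show ?thesis using S by (metis lessI)
    next
      case False
      then obtain T where "Q T" "T \<inter> \<Union>\<S> = {}" by blast
      with packing_insert[OF S(1) this ne] S(2) show ?thesis by metis
    qed
  qed (metis less_SucI)
qed

lemma card_Union_packing_le:
  assumes "packing Q \<S>" "\<And>S. Q S \<Longrightarrow> card S \<le> c"
  shows "card (\<Union>\<S>) \<le> card \<S> * c"
proof -
  have "card (\<Union>\<S>) \<le> sum card \<S>" by (rule card_Union_le_sum_card)
  also have "\<dots> \<le> card \<S> * c"
    using assms by (intro order.trans[OF sum_bounded_above]) (auto simp: packing_def)
  finally show ?thesis .
qed

lemma packing_hosts_imp_disjoint_copies:
  assumes "packing (hosts G H) \<S>" "card \<S> = k"
  shows "contains_disjoint_copies G k H"
proof -
  have "finite \<S>" using assms by (simp add: packing_def)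
  then obtain h where h: "bij_betw h {..<k} \<S>"
    using assms(2) by (metis ex_bij_betw_nat_finite lessThan_atLeast0)
  have "\<forall>i<k. \<exists>f. embedding f H G \<and> f ` fst H = h i"
    using h assms(1) unfolding packing_def hosts_def bij_betw_def by blast
  then obtain f where f: "\<forall>i<k. embedding (f i) H G \<and> f i ` fst H = h i" by metis
  have "h i \<inter> h j = {}" if "i < k" "j < k" "i \<noteq> j" for i j
  proof -
    have "h i \<noteq> h j" "h i \<in> \<S>" "h j \<in> \<S>"
      using h that unfolding bij_betw_def inj_on_def by auto
    then show ?thesis using assms(1) unfolding packing_def pairwise_def disjnt_def by blast
  qed
  then show ?thesis unfolding contains_disjoint_copies_def using f by metis
qed

lemma hosts_complete_bipartite:
  assumes B: "is_graph B" "W1 \<inter> W2 = {}" "W1 \<union> W2 = fst B"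
      "\<forall>e\<in>snd B. e \<inter> W1 \<noteq> {} \<and> e \<inter> W2 \<noteq> {}"
    and fin: "finite X" "finite Y" "card X = card W1" "card Y = card W2"
    and XY: "X \<inter> Y = {}" "X \<subseteq> V" "Y \<subseteq> V" "\<And>x y. x \<in> X \<Longrightarrow> y \<in> Y \<Longrightarrow> {x, y} \<in> E"
  shows "hosts (V, E) B (X \<union> Y)"
proof -
  have finW: "finite W1" "finite W2"
    using B(1,3) unfolding is_graph_def by (metis finite_Un)+
  obtain f where f: "bij_betw f W1 X" using finite_same_card_bij[OF finW(1) fin(1)] fin(3) by auto
  obtain g where g: "bij_betw g W2 Y" using finite_same_card_bij[OF finW(2) fin(2)] fin(4) by auto
  define h where "h v = (if v \<in> W1 then f v else g v)" for v
  have h1: "h ` W1 = X" using f unfolding h_def bij_betw_def by auto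
  have h2: "h ` W2 = Y" using g B(2) unfolding h_def bij_betw_def by (auto simp: image_def)
  have inj: "inj_on h (W1 \<union> W2)"
  proof (rule inj_onI)
    fix u v assume uv: "u \<in> W1 \<union> W2" "v \<in> W1 \<union> W2" "h u = h v"
    have "u \<in> W1 \<longleftrightarrow> v \<in> W1"
      using uv h1 h2 XY(1) by (metis UnE disjoint_iff imageI)
    then show "u = v"
      using uv f g B(2) unfolding h_def bij_betw_def inj_on_def by (auto split: if_splits)
  qed
  have "h ` e \<in> E" if e: "e \<in> snd B" for e
  proof -
    obtain u v where uv: "u \<in> e" "v \<in> e" "u \<in> W1" "v \<in> W2" using B(4) e by blast
    then have "u \<noteq> v" "card e = 2" using B(1,2) e unfolding is_graph_def by auto
    then have "e = {u, v}" using uv by (metis card_2_iff empty_iff insert_iff insert_commute)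
    then show ?thesis using XY(4)[of "h u" "h v"] uv h1 h2 by auto
  qed
  then have "embedding h B (V, E)"
    using inj B(3) h1 h2 XY unfolding embedding_def by (metis Un_least fst_conv image_Un snd_conv)
  moreover have "h ` fst B = X \<union> Y" using h1 h2 B(3) by (metis image_Un)
  ultimately show ?thesis unfolding hosts_def by blast
qed

text \<open>Vertices of B outside \<open>S\<close> may be adjacent to each other and to any vertex
  of \<open>S\<close>; hence \<open>T\<close> is a clique joined to the whole image of
  \<open>S\<close>.\<close>

lemma hosts_extend:
  assumes B: "is_graph B" and S: "S \<subseteq> fst B"
    and f: "embedding f (S, {e\<in>snd B. e \<subseteq> S}) (V, E)"
    and T: "finite T" "card T = card (fst B - S)" "T \<subseteq> V" "T \<inter> f ` S = {}"
    and TT: "\<And>x y. x \<in> T \<Longrightarrow> y \<in> T \<Longrightarrow> x \<noteq> y \<Longrightarrow> {x, y} \<in> E"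
    and TS: "\<And>x y. x \<in> T \<Longrightarrow> y \<in> f ` S \<Longrightarrow> {x, y} \<in> E"
  shows "hosts (V, E) B (f ` S \<union> T)"
proof -
  have finB: "finite (fst B)" using B unfolding is_graph_def by blast
  then obtain g where g: "bij_betw g (fst B - S) T"
    using finite_same_card_bij[OF _ T(1), of "fst B - S"] T(2) by auto
  define h where "h v = (if v \<in> S then f v else g v)" for v
  have h1: "h ` S = f ` S" unfolding h_def by auto
  have h2: "h ` (fst B - S) = T" using g unfolding h_def bij_betw_def by (auto simp: image_def)
  have fs: "inj_on f S" "f ` S \<subseteq> V" "\<forall>e\<in>snd B. e \<subseteq> S \<longrightarrow> f ` e \<in> E"
    using f unfolding embedding_def by auto
  have inj: "inj_on h (fst B)"
  proof (rule inj_onI)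
    fix u v assume uv: "u \<in> fst B" "v \<in> fst B" "h u = h v"
    have "u \<in> S \<longleftrightarrow> v \<in> S"
      using uv h1 h2 T(4) by (metis Diff_iff disjoint_iff imageI)
    then show "u = v"
      using uv fs(1) g unfolding h_def bij_betw_def inj_on_def by (auto split: if_splits)
  qed
  have "h ` e \<in> E" if e: "e \<in> snd B" for e
  proof -
    have e2: "card e = 2" "e \<subseteq> fst B" using B e unfolding is_graph_def by auto
    show ?thesis
    proof (cases "e \<subseteq> S")
      case True
      then have "h ` e = f ` e" unfolding h_def by auto
      then show ?thesis using fs(3) e True by simp
    next
      case False
      then obtain u where u: "u \<in> e" "u \<notin> S" by blast
      then obtain v where v: "e = {u, v}" "u \<noteq> v" using e2(1) by (auto simp: card_2_iff)
      have hu: "h u \<in> T" using u e2 h2 by blast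
      have "h u \<noteq> h v" using inj v e2 unfolding inj_on_def by auto
      moreover have "h v \<in> T \<or> h v \<in> f ` S" using v e2 h1 h2 by blast
      ultimately show ?thesis using hu TT TS v by auto
    qed
  qed
  moreover have im: "h ` fst B = f ` S \<union> T" using h1 h2 S by (metis Diff_partition image_Un)
  ultimately have "embedding h B (V, E)"
    using inj fs T unfolding embedding_def by auto
  then show ?thesis using im unfolding hosts_def by blast
qed

text \<open>Each chosen vertex rules out at most \<open>d\<close> candidates, itself included since
  \<open>{v}\<close> is no edge. The size condition is (k - 1) d < |A| written without
  subtraction.\<close>

lemma greedy_clique:
  assumes "finite A" "\<And>v. v \<in> A \<Longrightarrow> card {w\<in>A. {v, w} \<notin> E} \<le> d" "\<And>v. {v} \<notin> E"
    and "k * d < card A + d"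
  shows "\<exists>T\<subseteq>A. card T = k \<and> (\<forall>x\<in>T. \<forall>y\<in>T. x \<noteq> y \<longrightarrow> {x, y} \<in> E)"
  using assms
proof (induction k arbitrary: A)
  case 0
  show ?case by (intro exI[of _ "{}"]) auto
next
  case (Suc k)
  show ?case
  proof (cases "k = 0")
    case True
    then have "A \<noteq> {}" using Suc.prems(4) by auto
    then obtain v where "v \<in> A" by blast
    then show ?thesis using True by (intro exI[of _ "{v}"]) auto
  next
    case False
    then have "A \<noteq> {}" using Suc.prems(4) by (cases k) auto
    then obtain v where v: "v \<in> A" by blast
    define A' where "A' = {w\<in>A. {v, w} \<in> E}"
    have "A = A' \<union> {w\<in>A. {v, w} \<notin> E}" "A' \<inter> {w\<in>A. {v, w} \<notin> E} = {}" unfolding A'_def by auto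
    then have "card A = card A' + card {w\<in>A. {v, w} \<notin> E}"
      using Suc.prems(1) by (metis card_Un_disjoint finite_Un)
    then have 1: "k * d < card A' + d" using Suc.prems(2)[OF v] Suc.prems(4) by simp
    have 2: "card {w\<in>A'. {u, w} \<notin> E} \<le> d" if "u \<in> A'" for u
    proof -
      have "card {w\<in>A'. {u, w} \<notin> E} \<le> card {w\<in>A. {u, w} \<notin> E}"
        using Suc.prems(1) by (intro card_mono) (auto simp: A'_def)
      then show ?thesis using Suc.prems(2)[of u] that by (simp add: A'_def)
    qed
    have "finite A'" using Suc.prems(1) by (simp add: A'_def)
    from Suc.IH[OF this 2 Suc.prems(3) 1] obtain T
      where T: "T \<subseteq> A'" "card T = k" "\<forall>x\<in>T. \<forall>y\<in>T. x \<noteq> y \<longrightarrow> {x, y} \<in> E" by blast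
    have "v \<notin> A'" using Suc.prems(3) by (auto simp: A'_def)
    then have "card (insert v T) = Suc k"
      using T \<open>finite A'\<close> by (metis card_insert_disjoint finite_subset subsetD)
    moreover have "insert v T \<subseteq> A" using T v by (auto simp: A'_def)
    moreover have "\<forall>x\<in>insert v T. \<forall>y\<in>insert v T. x \<noteq> y \<longrightarrow> {x, y} \<in> E"
      using T by (auto simp: A'_def insert_commute)
    ultimately show ?thesis by blast
  qed
qed

section \<open>Counting edges and extremal numbers\<close>

definition nbr :: "'b set set \<Rightarrow> 'b \<Rightarrow> 'b set" where
  "nbr E v = {u. {v, u} \<in> E}"

definition edges_in :: "'b set set \<Rightarrow> 'b set \<Rightarrow> 'b set set" where
  "edges_in E X = {e \<in> E. e \<subseteq> X}"

lemma finite_edges: "is_graph (V, E) \<Longrightarrow> finite E"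
  by (rule finite_subset[of _ "Pow V"]) (auto simp: is_graph_def)

lemma finite_edges_in: "is_graph (V, E) \<Longrightarrow> finite (edges_in E X)"
  using finite_edges[of V E] by (auto simp: edges_in_def intro: finite_subset)

lemma nbr_subset: "is_graph (V, E) \<Longrightarrow> nbr E v \<subseteq> V - {v}"
  by (fastforce simp: is_graph_def nbr_def)

lemma finite_nbr: "is_graph (V, E) \<Longrightarrow> finite (nbr E v)"
  using nbr_subset[of V E v] by (auto simp: is_graph_def intro: finite_subset)

lemma edge_through:
  assumes "is_graph (V, E)" "e \<in> E" "v \<in> e"
  obtains u where "u \<in> nbr E v" "e = {v, u}"
proof -
  have "card e = 2" using assms by (auto simp: is_graph_def)
  then obtain u where "e = {v, u}" using assms(3) by (auto simp: card_2_iff)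
  then show ?thesis using assms(2) that by (auto simp: nbr_def)
qed

text \<open>The factor \<open>k\<close> carries a rational degree bound d / k through a count in
  natural numbers.\<close>

lemma card_UN_edges_le:
  assumes "finite R" "\<And>v. v \<in> R \<Longrightarrow> finite (f v)" "\<And>v. v \<in> R \<Longrightarrow> k * card (f v) \<le> d"
  shows "k * card (\<Union>v\<in>R. (\<lambda>u. {v, u}) ` f v) \<le> card R * d"
proof -
  have "card (\<Union>v\<in>R. (\<lambda>u. {v, u}) ` f v) \<le> (\<Sum>v\<in>R. card ((\<lambda>u. {v, u}) ` f v))"
    using assms by (intro card_UN_le) auto
  also have "\<dots> \<le> (\<Sum>v\<in>R. card (f v))"
    using assms by (intro sum_mono card_image_le) auto
  finally have "k * card (\<Union>v\<in>R. (\<lambda>u. {v, u}) ` f v) \<le> (\<Sum>v\<in>R. k * card (f v))"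
    by (simp add: sum_distrib_left[symmetric])
  also have "\<dots> \<le> card R * d" using assms(3) by (metis (mono_tags, lifting) of_nat_id sum_bounded_above)
  finally show ?thesis .
qed

lemma card_edges_in_remove:
  assumes G: "is_graph (V, E)" and R: "finite R" "\<And>v. v \<in> R \<Longrightarrow> k * card (nbr E v) \<le> d"
  shows "k * card (edges_in E Y) \<le> k * card (edges_in E (Y - R)) + card R * d"
proof -
  let ?X = "\<Union>v\<in>R. (\<lambda>u. {v, u}) ` nbr E v"
  have "edges_in E Y \<subseteq> edges_in E (Y - R) \<union> ?X"
  proof
    fix e assume e: "e \<in> edges_in E Y"
    show "e \<in> edges_in E (Y - R) \<union> ?X"
    proof (cases "e \<inter> R = {}")
      case True
      then show ?thesis using e by (auto simp: edges_in_def)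
    next
      case False
      then obtain v where v: "v \<in> e" "v \<in> R" by blast
      obtain u where "u \<in> nbr E v" "e = {v, u}"
        using edge_through[OF G _ v(1)] e by (auto simp: edges_in_def)
      then show ?thesis using v by blast
    qed
  qed
  then have "card (edges_in E Y) \<le> card (edges_in E (Y - R)) + card ?X"
    using finite_edges_in[OF G] R(1) finite_nbr[OF G]
    by (meson card_Un_le card_mono finite_UN_I finite_Un finite_imageI le_trans)
  then have "k * card (edges_in E Y) \<le> k * (card (edges_in E (Y - R)) + card ?X)" by (rule mult_left_mono) simp
  moreover have "k * card ?X \<le> card R * d"
    using R finite_nbr[OF G] by (intro card_UN_edges_le) auto
  ultimately show ?thesis by (simp add: algebra_simps)
qed

lemma card_edges_in_Un:
  assumes G: "is_graph (V, E)" and A: "finite A" "\<And>v. v \<in> A \<Longrightarrow> card (nbr E v \<inter> Z) \<le> d"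
  shows "card (edges_in E (A \<union> Z)) \<le> card (edges_in E A) + card (edges_in E Z) + card A * d"
proof -
  let ?X = "\<Union>v\<in>A. (\<lambda>u. {v, u}) ` (nbr E v \<inter> Z)"
  have "edges_in E (A \<union> Z) \<subseteq> edges_in E A \<union> edges_in E Z \<union> ?X"
  proof
    fix e assume e: "e \<in> edges_in E (A \<union> Z)"
    show "e \<in> edges_in E A \<union> edges_in E Z \<union> ?X"
    proof (cases "e \<subseteq> A \<or> e \<subseteq> Z")
      case True
      then show ?thesis using e by (auto simp: edges_in_def)
    next
      case False
      then obtain v w where v: "v \<in> e" "v \<in> A" "w \<in> e" "w \<in> Z" "w \<notin> A" using e by (auto simp: edges_in_def)
      obtain u where u: "u \<in> nbr E v" "e = {v, u}"
        using edge_through[OF G _ v(1)] e by (auto simp: edges_in_def)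
      then have "u = w" using v by auto
      then show ?thesis using u v by blast
    qed
  qed
  then have "card (edges_in E (A \<union> Z)) \<le> card (edges_in E A \<union> edges_in E Z \<union> ?X)"
    using finite_edges_in[OF G] A(1) finite_nbr[OF G] by (intro card_mono) auto
  also have "\<dots> \<le> card (edges_in E A) + card (edges_in E Z) + card ?X"
    by (meson add_le_mono1 card_Un_le le_trans)
  finally show ?thesis
    using card_UN_edges_le[of A "\<lambda>v. nbr E v \<inter> Z" 1 d] A finite_nbr[OF G] by simp
qed

lemma card_edges_in_degree:
  assumes G: "is_graph (V, E)" and A: "finite A" "\<And>v. v \<in> A \<Longrightarrow> card (nbr E v \<inter> A) \<le> d"
  shows "card (edges_in E A) \<le> card A * d"
proof -
  let ?X = "\<Union>v\<in>A. (\<lambda>u. {v, u}) ` (nbr E v \<inter> A)"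
  have "edges_in E A \<subseteq> ?X"
  proof
    fix e assume e: "e \<in> edges_in E A"
    then obtain v where v: "v \<in> e" using G by (fastforce simp: edges_in_def is_graph_def)
    obtain u where "u \<in> nbr E v" "e = {v, u}"
      using edge_through[OF G _ v] e by (auto simp: edges_in_def)
    then show "e \<in> ?X" using e by (auto simp: edges_in_def)
  qed
  then have "card (edges_in E A) \<le> card ?X"
    using A(1) finite_nbr[OF G] by (intro card_mono) auto
  then show ?thesis
    using card_UN_edges_le[of A "\<lambda>v. nbr E v \<inter> A" 1 d] A finite_nbr[OF G] by simp
qed

text \<open>Measures how far the vertices of \<open>L\<close> are from being joined to everything;
  it is empty in the extremal construction.\<close>

definition missing :: "'b set \<Rightarrow> 'b set set \<Rightarrow> 'b set \<Rightarrow> 'b set set" where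
  "missing V E L = {e. e \<subseteq> V \<and> card e = 2 \<and> e \<inter> L \<noteq> {} \<and> e \<notin> E}"

lemma finite_missing: "finite V \<Longrightarrow> finite (missing V E L)"
  by (rule finite_subset[of _ "Pow V"]) (auto simp: missing_def)

text \<open>The pairs in \<open>V\<close> are the edges meeting \<open>L\<close>, the non-edges
  meeting \<open>L\<close> and the pairs outside \<open>L\<close>. Adding the edges outside
  \<open>L\<close> on both sides avoids subtraction.\<close>

lemma card_edges_missing:
  assumes G: "is_graph (V, E)" and L: "L \<subseteq> V"
  shows "card E + card (missing V E L) + (card (V - L) choose 2)
    = (card V choose 2) + card (edges_in E (V - L))"
proof -
  have finV: "finite V" using G by (simp add: is_graph_def)
  define A where "A = {e\<in>E. e \<inter> L \<noteq> {}}"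
  define D where "D = {e. e \<subseteq> V - L \<and> card e = 2}"
  have E: "E = A \<union> edges_in E (V - L)" "A \<inter> edges_in E (V - L) = {}"
    using G by (auto simp: A_def edges_in_def is_graph_def)
  have cE: "card E = card A + card (edges_in E (V - L))"
    using E finite_edges[OF G] by (metis card_Un_disjoint finite_Un)
  have all: "{e. e \<subseteq> V \<and> card e = 2} = A \<union> missing V E L \<union> D"
    using G by (auto simp: A_def missing_def D_def is_graph_def)
  have "card {e. e \<subseteq> V \<and> card e = 2} = card (A \<union> missing V E L) + card D"
    unfolding all using finite_edges[OF G] finite_missing[OF finV, of E L] finV
    by (intro card_Un_disjoint) (auto simp: A_def missing_def D_def)
  also have "card (A \<union> missing V E L) = card A + card (missing V E L)"
    using finite_edges[OF G] finite_missing[OF finV, of E L]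
    by (intro card_Un_disjoint) (auto simp: A_def missing_def)
  finally have "card V choose 2 = card A + card (missing V E L) + (card (V - L) choose 2)"
    using n_subsets[OF finV, of 2] n_subsets[of "V - L" 2] finV unfolding D_def by simp
  then show ?thesis using cE by simp
qed

text \<open>Double counting of the ordered pairs (v, w) with w in \<open>f v\<close>: each is a
  non-edge meeting \<open>L\<close>, and an unordered pair arises at most twice.\<close>

lemma card_missing_ge:
  assumes V: "finite V" and X: "X \<subseteq> V"
    and f: "\<And>v. v \<in> X \<Longrightarrow> f v \<subseteq> V - nbr E v - {v}" "\<And>v. v \<in> X \<Longrightarrow> v \<in> L \<or> f v \<subseteq> L"
    and c: "\<And>v. v \<in> X \<Longrightarrow> c \<le> k * card (f v)"
  shows "card X * c \<le> 2 * k * card (missing V E L)"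
proof -
  let ?M = "missing V E L"
  let ?p = "\<lambda>e. {(a, b). {a, b} = e}"
  have p2: "finite (?p e) \<and> card (?p e) \<le> 2" if e: "e \<in> ?M" for e
  proof -
    obtain x y where xy: "e = {x, y}" using e by (auto simp: missing_def card_2_iff)
    have sub: "?p e \<subseteq> {(x, y), (y, x)}" unfolding xy by (auto simp: doubleton_eq_iff)
    have "card (?p e) \<le> card {(x, y), (y, x)}" by (rule card_mono[OF _ sub]) simp
    also have "\<dots> \<le> 2" by (cases "x = y") auto
    finally show ?thesis using finite_subset[OF sub] by simp
  qed
  have finX: "finite X" using V X finite_subset by blast
  have finf: "finite (f v)" if "v \<in> X" for v
    using f(1)[OF that] V by (meson Diff_subset finite_subset)
  have "Sigma X f \<subseteq> (\<Union>e\<in>?M. ?p e)"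
  proof
    fix z assume "z \<in> Sigma X f"
    then obtain v w where vw: "z = (v, w)" "v \<in> X" "w \<in> f v" by auto
    then have "w \<in> V" "w \<noteq> v" "{v, w} \<notin> E" "v \<in> V" "v \<in> L \<or> w \<in> L"
      using f[OF vw(2)] X by (auto simp: nbr_def)
    then have "{v, w} \<in> ?M" by (auto simp: missing_def)
    then show "z \<in> (\<Union>e\<in>?M. ?p e)" using vw(1) by blast
  qed
  then have "card (Sigma X f) \<le> card (\<Union>e\<in>?M. ?p e)"
    using p2 finite_missing[OF V, of E L] by (intro card_mono) auto
  also have "\<dots> \<le> (\<Sum>e\<in>?M. card (?p e))"
    by (rule card_UN_le[OF finite_missing[OF V]])
  also have "\<dots> \<le> card ?M * 2"
    using p2 by (metis (no_types, lifting) of_nat_id sum_bounded_above)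
  finally have "(\<Sum>v\<in>X. card (f v)) \<le> 2 * card ?M"
    using card_SigmaI[OF finX, of f] finf by simp
  then have "k * (\<Sum>v\<in>X. card (f v)) \<le> k * (2 * card ?M)" by (rule mult_left_mono) simp
  moreover have "card X * c \<le> (\<Sum>v\<in>X. k * card (f v))"
    using c by (metis (mono_tags, lifting) of_nat_id sum_bounded_below)
  ultimately show ?thesis by (simp add: sum_distrib_left)
qed

section \<open>Extremal numbers under disjoint unions and relabelling\<close>

lemma finite_ex_prop: "finite {card E | E. is_graph ({0..<n::nat}, E) \<and> P ({0..<n}, E)}"
proof (rule finite_subset)
  show "{card E | E. is_graph ({0..<n}, E) \<and> P ({0..<n}, E)} \<subseteq> card ` Pow (Pow {0..<n})"
    by (auto simp: is_graph_def)
qed simp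

lemma ex_prop_ge:
  "is_graph ({0..<n}, E) \<Longrightarrow> P ({0..<n}, E) \<Longrightarrow> card E \<le> ex_prop n P"
  unfolding ex_prop_def by (rule Max_ge[OF finite_ex_prop]) auto

lemma ex_prop_attained:
  assumes "is_graph ({0..<n}, E0)" "P ({0..<n}, E0)"
  obtains E where "is_graph ({0..<n}, E)" "P ({0..<n}, E)" "card E = ex_prop n P"
proof -
  have "ex_prop n P \<in> {card E | E. is_graph ({0..<n}, E) \<and> P ({0..<n}, E)}"
    unfolding ex_prop_def by (rule Max_in[OF finite_ex_prop]) (use assms in auto)
  then show ?thesis using that by auto
qed

text \<open>Disjoint unions of B-free graphs are B-free because B is connected; this makes
  the extremal number superadditive.\<close>

lemma ex_graph_superadditive:
  assumes conn: "graph_connected B" and noiso: "\<And>v. v \<in> fst B \<Longrightarrow> \<exists>e\<in>snd B. v \<in> e"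
    and B: "is_graph B"
    and F: "is_graph (A, F)" "card A = u" "0 < u" "\<not> contains_copy (A, F) B"
  shows "card F * (n div u) \<le> ex_graph n B"
proof -
  have finA: "finite A" using F by (simp add: is_graph_def)
  obtain h where h: "bij_betw h A {0..<u}"
    using ex_bij_betw_finite_nat[OF finA] F(2) by auto
  have hinj: "inj_on h A" and hu: "\<And>a. a \<in> A \<Longrightarrow> h a < u"
    using h unfolding bij_betw_def by auto
  define q where "q = n div u"
  \<comment> \<open>Block \<open>i\<close> of length \<open>u\<close> carries the i-th copy of F, so
    \<open>div u\<close> tells the copy and \<open>mod u\<close> the position in it.\<close>
  define \<phi> where "\<phi> i a = i * u + h a" for i a
  have pd: "\<phi> i a div u = i" "\<phi> i a mod u = h a" if "a \<in> A" for i a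
    using hu[OF that] unfolding \<phi>_def by auto
  have pinj: "inj_on (\<phi> i) A" for i using hinj unfolding \<phi>_def inj_on_def by auto
  have plt: "\<phi> i a < n" if "i < q" "a \<in> A" for i a
  proof -
    have "\<phi> i a < (i + 1) * u" using hu[OF that(2)] unfolding \<phi>_def by simp
    also have "\<dots> \<le> q * u" using that by (intro mult_right_mono) auto
    also have "\<dots> \<le> n" unfolding q_def by simp
    finally show ?thesis .
  qed
  have FA: "e \<subseteq> A" "card e = 2" "e \<noteq> {}" if "e \<in> F" for e
    using F(1) that by (auto simp: is_graph_def)
  define E' where "E' = (\<lambda>(i, e). \<phi> i ` e) ` ({..<q} \<times> F)"
  have "inj_on (\<lambda>(i, e). \<phi> i ` e) ({..<q} \<times> F)"
  proof (rule inj_onI, clarify)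
    fix i e j e' assume a: "e \<in> F" "e' \<in> F" "\<phi> i ` e = \<phi> j ` e'"
    obtain x where x: "x \<in> e" using FA[OF a(1)] by blast
    then obtain y where y: "y \<in> e'" "\<phi> i x = \<phi> j y" using a(3) by blast
    then have ij: "i = j" using pd(1) x FA[OF a(1)] FA[OF a(2)] by (metis subsetD)
    then show "i = j \<and> e = e'" using a pinj FA by (metis inj_on_image_eq_iff)
  qed
  then have cE: "card E' = card F * q" unfolding E'_def by (simp add: card_image card_cartesian_product)
  have gE: "is_graph ({0..<n}, E')"
  proof -
    have "card (\<phi> i ` e) = 2 \<and> \<phi> i ` e \<subseteq> {0..<n}" if "i < q" "e \<in> F" for i e
      using FA[OF that(2)] plt[OF that(1)] card_image[OF inj_on_subset[OF pinj]] by auto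
    then show ?thesis by (auto simp: is_graph_def E'_def)
  qed
  have "\<not> contains_copy ({0..<n}, E') B"
  proof
    assume "contains_copy ({0..<n}, E') B"
    then obtain f where f: "inj_on f (fst B)" "\<And>e. e \<in> snd B \<Longrightarrow> f ` e \<in> E'"
      unfolding contains_copy_def embedding_def by auto
    define k where "k v = inv_into A h (f v mod u)" for v
    have fe: "\<exists>e'\<in>F. k ` e = e' \<and> (\<forall>v\<in>e. f v div u = i \<and> f v mod u = h (k v) \<and> k v \<in> A)"
      if i: "f ` e = \<phi> i ` e'" "e' \<in> F" for e e' i
    proof -
      have fv: "\<exists>a\<in>e'. f v = \<phi> i a \<and> k v = a" if "v \<in> e" for v
      proof -
        obtain a where "a \<in> e'" "f v = \<phi> i a" using i \<open>v \<in> e\<close> by (metis image_iff)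
        then show ?thesis using FA[OF i(2)] hinj pd by (auto simp: k_def)
      qed
      have "k ` e \<subseteq> e'" using fv by auto
      moreover have "e' \<subseteq> k ` e"
      proof
        fix a assume "a \<in> e'"
        then obtain v where v: "v \<in> e" "\<phi> i a = f v" using i(1) by (metis image_iff)
        obtain b where b: "b \<in> e'" "f v = \<phi> i b" "k v = b" using fv[OF v(1)] by blast
        then have "a = b" using v pinj FA[OF i(2)] \<open>a \<in> e'\<close> unfolding inj_on_def by (metis subsetD)
        then show "a \<in> k ` e" using b v by auto
      qed
      ultimately have "k ` e = e'" by blast
      moreover have "\<forall>v\<in>e. f v div u = i \<and> f v mod u = h (k v) \<and> k v \<in> A"
        using fv pd FA[OF i(2)] by (metis subsetD)
      ultimately show ?thesis using i(2) by blast
    qed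
    have fe': "\<exists>i. k ` e \<in> F \<and> (\<forall>v\<in>e. f v div u = i \<and> f v mod u = h (k v) \<and> k v \<in> A)" if e: "e \<in> snd B" for e
    proof -
      obtain i e' where "f ` e = \<phi> i ` e'" "e' \<in> F" using f(2)[OF e] unfolding E'_def by auto
      then show ?thesis using fe by blast
    qed
    have step: "f x div u = f y div u" if "{x, y} \<in> snd B" for x y
      using fe'[OF that] by auto
    \<comment> \<open>Adjacent vertices of B land in the same block and B is connected, so a whole
      copy lies in one block and \<open>k\<close> folds it injectively back into
      \<open>A\<close>.\<close>
    have const: "f x div u = f y div u" if "x \<in> fst B" "y \<in> fst B" for x y
    proof -
      have "(\<lambda>x y. {x, y} \<in> snd B)\<^sup>*\<^sup>* x y" using conn that by (auto simp: graph_connected_def)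
      then show ?thesis by induction (use step in auto)
    qed
    have kv: "f v mod u = h (k v)" "k v \<in> A" if "v \<in> fst B" for v
      using noiso[OF that] fe' by metis+
    have "inj_on k (fst B)"
    proof (rule inj_onI)
      fix x y assume xy: "x \<in> fst B" "y \<in> fst B" "k x = k y"
      have "f x mod u = f y mod u" "f x div u = f y div u"
        using kv(1)[OF xy(1)] kv(1)[OF xy(2)] xy(3) const[OF xy(1,2)] by simp_all
      then have "f x = f y" by (metis div_mult_mod_eq)
      then show "x = y" using f(1) xy by (auto simp: inj_on_def)
    qed
    then have "embedding k B (A, F)"
      unfolding embedding_def using kv(2) fe' by (simp add: image_subset_iff)
    then show False using F(4) by (auto simp: contains_copy_def)
  qed
  then have "card E' \<le> ex_graph n B"
    unfolding ex_graph_def ex_family_def using gE by (intro ex_prop_ge) auto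
  then show ?thesis using cE by (simp add: q_def)
qed

text \<open>Members of the family may have isolated vertices, so padding with new vertices
  preserves freeness only if the graph is already as large as the forbidden graphs.\<close>

lemma card_le_ex_family:
  assumes F: "is_graph (Z, F)" "card Z \<le> m" "\<And>H. H \<in> \<F> \<Longrightarrow> \<not> contains_copy (Z, F) H"
    and H: "\<And>H. H \<in> \<F> \<Longrightarrow> is_graph H \<and> card (fst H) \<le> card Z"
  shows "card F \<le> ex_family m \<F>"
proof -
  have finZ: "finite Z" using F by (simp add: is_graph_def)
  obtain h where h: "bij_betw h Z {0..<card Z}"
    using ex_bij_betw_finite_nat[OF finZ] by auto
  have hinj: "inj_on h Z" and hZ: "h ` Z = {0..<card Z}" using h unfolding bij_betw_def by auto
  define E' where "E' = (`) h ` F"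
  have FZ: "e \<subseteq> Z" "card e = 2" if "e \<in> F" for e using F(1) that by (auto simp: is_graph_def)
  have "inj_on ((`) h) F"
    by (rule inj_onI) (use inj_on_image_eq_iff[OF hinj] FZ(1) in blast)
  then have cE: "card E' = card F" unfolding E'_def by (rule card_image)
  have "card (h ` e) = 2 \<and> h ` e \<subseteq> {0..<m}" if "e \<in> F" for e
  proof
    show "card (h ` e) = 2" using FZ[OF that] card_image[OF inj_on_subset[OF hinj]] by auto
    have "h ` e \<subseteq> {0..<card Z}" using FZ[OF that] hZ by blast
    then show "h ` e \<subseteq> {0..<m}" using F(2) by auto
  qed
  then have gE: "is_graph ({0..<m}, E')" by (auto simp: is_graph_def E'_def)
  have "\<not> contains_copy ({0..<m}, E') H" if HF: "H \<in> \<F>" for H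
  proof
    assume "contains_copy ({0..<m}, E') H"
    then obtain f where f: "inj_on f (fst H)" "\<And>e. e \<in> snd H \<Longrightarrow> f ` e \<in> E'"
      unfolding contains_copy_def embedding_def by auto
    have Hg: "finite (fst H)" "\<And>e. e \<in> snd H \<Longrightarrow> e \<subseteq> fst H" "card (fst H) \<le> card Z"
      using H[OF HF] by (auto simp: is_graph_def)
    \<comment> \<open>Only the non-isolated vertices of \<open>H\<close> are forced into the image
      of \<open>Z\<close>; the others are placed anew on free vertices of \<open>Z\<close>, which
      exist by the size hypothesis.\<close>
    define I where "I = \<Union>(snd H)"
    have IH: "I \<subseteq> fst H" using Hg by (auto simp: I_def)
    have fI: "f ` I \<subseteq> h ` Z"
    proof -
      have "f ` e \<subseteq> h ` Z" if "e \<in> snd H" for e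
        using f(2)[OF that] FZ unfolding E'_def by blast
      then show ?thesis by (auto simp: I_def)
    qed
    define k where "k v = inv_into Z h (f v)" for v
    have kI: "k ` I \<subseteq> Z" using fI unfolding k_def by (auto intro!: inv_into_into)
    have hk: "h (k v) = f v" if "v \<in> I" for v
      using fI that unfolding k_def by (metis f_inv_into_f imageI subsetD)
    have kinj: "inj_on k I" using hk f(1) IH unfolding inj_on_def by (metis subsetD)
    have finI: "finite I" using IH Hg(1) finite_subset by blast
    have "card (fst H - I) \<le> card (Z - k ` I)"
      using Hg(3) IH kI finI kinj by (simp add: card_Diff_subset card_image)
    then obtain g where g: "inj_on g (fst H - I)" "g ` (fst H - I) \<subseteq> Z - k ` I"
      using card_le_inj[of "fst H - I" "Z - k ` I"] Hg(1) finZ by auto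
    define r where "r v = (if v \<in> I then k v else g v)" for v
    have "inj_on r (fst H)"
    proof (rule inj_onI)
      fix x y assume xy: "x \<in> fst H" "y \<in> fst H" "r x = r y"
      have "g v \<notin> k ` I" if "v \<in> fst H" "v \<notin> I" for v using g(2) that by blast
      then have "x \<in> I \<longleftrightarrow> y \<in> I" using xy unfolding r_def by (metis imageI)
      then show "x = y" using xy kinj g(1) unfolding r_def inj_on_def by (auto split: if_splits)
    qed
    moreover have "r ` fst H \<subseteq> Z" using g(2) kI unfolding r_def by auto
    moreover have "r ` e \<in> F" if e: "e \<in> snd H" for e
    proof -
      obtain e' where e': "e' \<in> F" "f ` e = h ` e'" using f(2)[OF e] unfolding E'_def by auto
      have eI: "e \<subseteq> I" using e by (auto simp: I_def)
      then have "r ` e = k ` e" unfolding r_def by auto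
      moreover have "h ` (k ` e) = h ` e'" using hk eI e'(2) by (metis image_cong image_image subsetD)
      moreover have "k ` e \<subseteq> Z" using kI eI by blast
      ultimately show ?thesis using hinj FZ[OF e'(1)] e'(1) by (metis inj_on_image_eq_iff)
    qed
    ultimately have "embedding r H (Z, F)" by (auto simp: embedding_def)
    then show False using F(3)[OF HF] by (auto simp: contains_copy_def)
  qed
  then have "card E' \<le> ex_family m \<F>"
    unfolding ex_family_def using gE by (intro ex_prop_ge) auto
  then show ?thesis using cE by simp
qed

section \<open>Bipartite graphs with full covering number\<close>

lemma hosts_nonempty: "hosts G B S \<Longrightarrow> fst B \<noteq> {} \<Longrightarrow> S \<noteq> {}"
  by (auto simp: hosts_def)

lemma hosts_subset: "hosts G B S \<Longrightarrow> S \<subseteq> fst G"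
  by (auto simp: hosts_def embedding_def)

lemma hosts_card: "hosts G B S \<Longrightarrow> card S = card (fst B)"
  by (auto simp: hosts_def embedding_def card_image)

locale covered_bipartite =
  fixes B :: "'a set \<times> 'a set set" and s1 s2 :: nat and W1 W2 :: "'a set"
  assumes s1_ge: "2 \<le> s1" and s1_le: "s1 \<le> s2"
    and graph: "is_graph B" and conn: "graph_connected B"
    and cover: "cover_number B = s1"
    and parts: "W1 \<inter> W2 = {}" "W1 \<union> W2 = fst B" "card W1 = s1" "card W2 = s2"
      "\<forall>e\<in>snd B. e \<inter> W1 \<noteq> {} \<and> e \<inter> W2 \<noteq> {}"
begin

lemma finite_B: "finite (fst B)"
  using graph by (simp add: is_graph_def)

lemma card_B: "card (fst B) = s1 + s2"
  using parts finite_B by (metis card_Un_disjoint finite_Un)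

lemma B_nonempty: "fst B \<noteq> {}"
  using card_B s1_ge by auto

lemma no_isolated:
  assumes "v \<in> fst B" shows "\<exists>e\<in>snd B. v \<in> e"
proof -
  have "fst B \<noteq> {v}" using card_B s1_ge s1_le by auto
  then obtain u where u: "u \<in> fst B" "u \<noteq> v" using assms by blast
  have "(\<lambda>x y. {x, y} \<in> snd B)\<^sup>*\<^sup>* v u" using conn assms u by (auto simp: graph_connected_def)
  then show ?thesis using u(2) by (cases rule: converse_rtranclpE) auto
qed

text \<open>The complement of an edge-free \<open>S\<close> would be a vertex cover of size s1 - 1.
  Consequently the empty graph avoids the family, and its extremal number is a maximum over a
  nonempty set.\<close>

lemma induced_has_edge:
  assumes "S \<subseteq> fst B" "card S = Suc s2" shows "\<exists>e\<in>snd B. e \<subseteq> S"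
proof (rule ccontr)
  assume no: "\<not> ?thesis"
  let ?C = "fst B - S"
  have "e \<inter> ?C \<noteq> {}" if "e \<in> snd B" for e
  proof -
    have "e \<subseteq> fst B" using graph that by (auto simp: is_graph_def)
    then show ?thesis using no that by blast
  qed
  then have "cover_number B \<le> card ?C"
    unfolding cover_number_def by (intro Least_le) blast
  moreover have "card ?C = s1 + s2 - Suc s2"
    using assms finite_B card_B by (simp add: card_Diff_subset finite_subset)
  ultimately show False using cover s1_ge by simp
qed

abbreviation fam :: "('a set \<times> 'a set set) set" where
  "fam \<equiv> induced_family B (s2 + 1)"

lemma fam_graph: "H \<in> fam \<Longrightarrow> is_graph H \<and> card (fst H) = Suc s2"
  using graph finite_B finite_subset by (fastforce simp: induced_family_def is_graph_def)

text \<open>\<open>m\<close> is n - s1 (t + 1) + 1; the additive hypothesis keeps truncated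
  subtraction out.\<close>

lemma join_construction:
  assumes m: "m + s1 * (t + 1) = n + 1"
  obtains E where "is_graph ({0..<n}, E)" "\<not> contains_disjoint_copies ({0..<n}, E) (t + 1) B"
    "card E + (m choose 2) = (n choose 2) + ex_family m fam"
proof -
  have free0: "\<forall>H\<in>fam. \<not> contains_copy ({0..<m}, {}::nat set set) H"
  proof
    fix H assume "H \<in> fam"
    then obtain S where S: "H = (S, {e\<in>snd B. e \<subseteq> S})" "S \<subseteq> fst B" "card S = Suc s2"
      by (auto simp: induced_family_def)
    then obtain e where "e \<in> snd H" using induced_has_edge[OF S(2,3)] by auto
    then show "\<not> contains_copy ({0..<m}, {}::nat set set) H"
      by (auto simp: contains_copy_def embedding_def)
  qed
  have "is_graph ({0..<m}, {})" by (simp add: is_graph_def)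
  from ex_prop_attained[of m "{}" "\<lambda>G. \<forall>H\<in>fam. \<not> contains_copy G H", OF this free0]
  obtain E' where E': "is_graph ({0..<m}, E')" "\<forall>H\<in>fam. \<not> contains_copy ({0..<m}, E') H"
      "card E' = ex_family m fam"
    unfolding ex_family_def by blast
  define V where "V = {0..<n}"
  define L where "L = {m..<n}"
  have "s1 * (t + 1) \<ge> 1" using s1_ge by simp
  then have mn: "m \<le> n" using m by linarith
  have L: "L \<subseteq> V" "V - L = {0..<m}" "card L + 1 = s1 * (t + 1)"
    using mn m unfolding L_def V_def by auto
  define E where "E = E' \<union> {e. e \<subseteq> V \<and> card e = 2 \<and> e \<inter> L \<noteq> {}}"
  have gE: "is_graph (V, E)" using E'(1) mn unfolding is_graph_def E_def V_def by fastforce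
  have "missing V E L = {}" by (auto simp: missing_def E_def)
  moreover have in0: "edges_in E (V - L) = E'"
    using E'(1) L by (auto simp: edges_in_def E_def is_graph_def)
  ultimately have "card E + (m choose 2) = (n choose 2) + ex_family m fam"
    using card_edges_missing[OF gE L(1)] L(2) E'(3) by (simp add: V_def)
  moreover have "\<not> contains_disjoint_copies (V, E) (t + 1) B"
  proof
    assume "contains_disjoint_copies (V, E) (t + 1) B"
    then obtain f where f: "\<forall>i<t+1. embedding (f i) B (V, E)"
      "\<forall>i<t+1. \<forall>j<t+1. i \<noteq> j \<longrightarrow> f i ` fst B \<inter> f j ` fst B = {}"
      unfolding contains_disjoint_copies_def by (elim exE conjE)
    have big: "s1 \<le> card (f i ` fst B \<inter> L)" if i: "i < t + 1" for i
    proof (rule ccontr)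
      assume small: "\<not> ?thesis"
      have emb: "inj_on (f i) (fst B)" "f i ` fst B \<subseteq> V" "\<And>e. e \<in> snd B \<Longrightarrow> f i ` e \<in> E"
        using f(1)[rule_format, OF i] unfolding embedding_def by auto
      let ?S = "{v\<in>fst B. f i v \<notin> L}"
      have "f i ` fst B \<inter> L = f i ` (fst B - ?S)" by auto
      then have "card (f i ` fst B \<inter> L) = card (fst B - ?S)"
        using card_image[OF inj_on_subset[OF emb(1)], of "fst B - ?S"] by auto
      also have "\<dots> = s1 + s2 - card ?S" using finite_B card_B by (subst card_Diff_subset) auto
      finally have "Suc s2 \<le> card ?S" using small by linarith
      then obtain S where S: "S \<subseteq> ?S" "card S = Suc s2"
        by (meson obtain_subset_with_card_n)
      have "f i ` S \<subseteq> {0..<m}" using S emb(2) L(2) by blast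
      moreover have "f i ` e \<in> E'" if "e \<in> snd B" "e \<subseteq> S" for e
      proof -
        have "f i ` e \<subseteq> V - L" using that S emb(2) by blast
        then show ?thesis using emb(3)[OF that(1)] in0 by (auto simp: edges_in_def)
      qed
      moreover have "inj_on (f i) S" using emb(1) S(1) by (auto simp: inj_on_def)
      ultimately have "embedding (f i) (S, {e\<in>snd B. e \<subseteq> S}) ({0..<m}, E')"
        unfolding embedding_def by auto
      moreover have "(S, {e\<in>snd B. e \<subseteq> S}) \<in> fam"
        using S unfolding induced_family_def by auto
      ultimately show False using E'(2) by (auto simp: contains_copy_def)
    qed
    have "card (\<Union>i\<in>{..<t+1}. f i ` fst B \<inter> L) = (\<Sum>i\<in>{..<t+1}. card (f i ` fst B \<inter> L))"
      using f(2) by (intro card_UN_disjoint) (simp_all add: L_def, blast)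
    also have "\<dots> \<ge> (\<Sum>i\<in>{..<t+1}. s1)" using big by (intro sum_mono) auto
    finally have "s1 * (t + 1) \<le> card (\<Union>i\<in>{..<t+1}. f i ` fst B \<inter> L)" by (simp add: mult.commute)
    also have "\<dots> \<le> card L" by (intro card_mono) (auto simp: L_def)
    finally show False using L(3) by simp
  qed
  ultimately show ?thesis using that gE by (simp add: V_def)
qed

text \<open>\<open>\<Phi> q L'\<close> is an invariant ensuring that \<open>q\<close> more groups
  can be taken from \<open>L'\<close>; it is instantiated once with C spare vertices and once with
  none. The large sides \<open>Y\<close> avoid the used vertices and the whole reserve
  \<open>L'\<close>, so \<open>L\<close> is spent on small sides only and the avoided set grows by
  s2 per step, as \<open>N\<close> allows for.\<close>

lemma greedy_packing:
  assumes G: "is_graph (V, E)" and L: "L \<subseteq> V"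
    and step: "\<And>q L' X. L' \<subseteq> L \<Longrightarrow> \<Phi> (Suc q) L' \<Longrightarrow> X \<subseteq> V \<Longrightarrow> card X + s2 \<le> N \<Longrightarrow>
      \<exists>g\<subseteq>L'. \<exists>Y\<subseteq>V - X. card g = s1 \<and> card Y = s2 \<and> (\<forall>x\<in>g. \<forall>y\<in>Y. {x, y} \<in> E) \<and> \<Phi> q (L' - g)"
  shows "L' \<subseteq> L \<Longrightarrow> \<Phi> q L' \<Longrightarrow> P \<subseteq> V \<Longrightarrow> P \<inter> L' = {} \<Longrightarrow> card (P \<union> L') + s2 * q \<le> N \<Longrightarrow>
    \<exists>\<T>. packing (hosts (V, E) B) \<T> \<and> card \<T> = q \<and> \<Union>\<T> \<inter> P = {}"
proof (induction q arbitrary: L' P)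
  case 0
  show ?case by (rule exI[of _ "{}"]) simp
next
  case (Suc q)
  have finV: "finite V" using G by (simp add: is_graph_def)
  have "P \<union> L' \<subseteq> V" "card (P \<union> L') + s2 \<le> N" using Suc.prems L by auto
  from step[OF Suc.prems(1,2) this]
  obtain g Y where gY: "g \<subseteq> L'" "Y \<subseteq> V - (P \<union> L')" "card g = s1" "card Y = s2"
      "\<forall>x\<in>g. \<forall>y\<in>Y. {x, y} \<in> E" "\<Phi> q (L' - g)"
    by blast
  have sub: "g \<subseteq> V" "Y \<subseteq> V" "P \<subseteq> V" "L' \<subseteq> V" using gY Suc.prems L by auto
  have fin: "finite g" "finite Y" using sub finV finite_subset by blast+
  have disj: "g \<inter> Y = {}" using gY by auto
  have host: "hosts (V, E) B (g \<union> Y)"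
    using hosts_complete_bipartite[OF graph parts(1,2,5) fin _ _ disj sub(1,2)] gY parts by auto
  let ?P = "P \<union> g \<union> Y"
  have eq: "?P \<union> (L' - g) = (P \<union> L') \<union> Y" using gY by auto
  have "card (?P \<union> (L' - g)) \<le> card (P \<union> L') + s2"
    unfolding eq using card_Un_le[of "P \<union> L'" Y] gY(4) by simp
  then have "card (?P \<union> (L' - g)) + s2 * q \<le> N" using Suc.prems(5) by simp
  moreover have "?P \<inter> (L' - g) = {}" using gY Suc.prems by auto
  moreover have "L' - g \<subseteq> L" "?P \<subseteq> V" using Suc.prems sub by auto
  ultimately obtain \<T> where T: "packing (hosts (V, E) B) \<T>" "card \<T> = q" "\<Union>\<T> \<inter> ?P = {}"
    using Suc.IH[of "L' - g" ?P] gY(6) by blast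
  have "(g \<union> Y) \<inter> \<Union>\<T> = {}" using T(3) by blast
  from packing_insert[OF T(1) host this hosts_nonempty[OF host B_nonempty]]
  have "packing (hosts (V, E) B) (insert (g \<union> Y) \<T>)" "card (insert (g \<union> Y) \<T>) = Suc q"
    using T(2) by auto
  moreover have "\<Union>(insert (g \<union> Y) \<T>) \<inter> P = {}" using T(3) gY Suc.prems(4) by auto
  ultimately show ?case by blast
qed

text \<open>The sets are completed one after the other by s1 - 1 vertices of \<open>L\<close> each,
  so \<open>ext\<close> never has to avoid more vertices than all completions together
  occupy.\<close>

lemma attach_packing:
  assumes S: "finite \<S>" "pairwise disjnt \<S>" "\<And>S. S \<in> \<S> \<Longrightarrow> S \<inter> L = {}"
    and L: "finite L"
    and ext: "\<And>S X. S \<in> \<S> \<Longrightarrow> X \<subseteq> L \<Longrightarrow> card X \<le> card \<S> * (s1 - 1) \<Longrightarrow>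
      \<exists>T\<subseteq>L - X. card T = s1 - 1 \<and> hosts G B (S \<union> T)"
  shows "\<exists>\<T>. packing (hosts G B) \<T> \<and> card \<T> = card \<S> \<and> card (\<Union>\<T> \<inter> L) \<le> card \<S> * (s1 - 1)"
proof -
  \<comment> \<open>The final inclusion strengthens the induction: it keeps the next set disjoint
    from the copies built so far.\<close>
  have "\<exists>\<T>. packing (hosts G B) \<T> \<and> card \<T> = card \<R> \<and> card (\<Union>\<T> \<inter> L) \<le> card \<R> * (s1 - 1)
      \<and> \<Union>\<T> \<subseteq> \<Union>\<R> \<union> L" if "\<R> \<subseteq> \<S>" for \<R>
    using finite_subset[OF that S(1)] that
  proof (induction \<R> rule: finite_induct)
    case empty
    show ?case by (rule exI[of _ "{}"]) simp
  next
    case (insert S \<R>)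
    then obtain \<T> where T: "packing (hosts G B) \<T>" "card \<T> = card \<R>"
      "card (\<Union>\<T> \<inter> L) \<le> card \<R> * (s1 - 1)" "\<Union>\<T> \<subseteq> \<Union>\<R> \<union> L" by auto
    have "card \<R> \<le> card \<S>" using insert.prems S(1) by (auto intro: card_mono)
    then have "card (\<Union>\<T> \<inter> L) \<le> card \<S> * (s1 - 1)" using T(3) by (meson le_trans mult_le_mono1)
    then obtain U where U: "U \<subseteq> L - \<Union>\<T> \<inter> L" "card U = s1 - 1" "hosts G B (S \<union> U)"
      using ext[of S "\<Union>\<T> \<inter> L"] insert.prems by auto
    have "S \<inter> R = {}" if "R \<in> \<R>" for R
      using pairwiseD[OF S(2), of S R] that insert.hyps(2) insert.prems
      by (auto simp: disjnt_def)
    then have "S \<inter> \<Union>\<R> = {}" by blast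
    then have dj: "(S \<union> U) \<inter> \<Union>\<T> = {}"
      using T(4) U(1) S(3)[of S] insert.prems by blast
    note ins = packing_insert[OF T(1) U(3) dj hosts_nonempty[OF U(3) B_nonempty]]
    have "\<Union>(insert (S \<union> U) \<T>) \<inter> L \<subseteq> U \<union> (\<Union>\<T> \<inter> L)" using S(3)[of S] insert.prems by blast
    moreover have "finite (U \<union> (\<Union>\<T> \<inter> L))" using U(1) L by (auto intro: finite_subset)
    ultimately have "card (\<Union>(insert (S \<union> U) \<T>) \<inter> L) \<le> card (U \<union> (\<Union>\<T> \<inter> L))"
      by (rule card_mono[rotated])
    also have "\<dots> \<le> (s1 - 1) + card \<R> * (s1 - 1)"
      using card_Un_le[of U "\<Union>\<T> \<inter> L"] T(3) U(2) by linarith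
    finally have "card (\<Union>(insert (S \<union> U) \<T>) \<inter> L) \<le> card (insert S \<R>) * (s1 - 1)"
      using insert.hyps by simp
    moreover have "\<Union>(insert (S \<union> U) \<T>) \<subseteq> \<Union>(insert S \<R>) \<union> L" using T(4) U(1) by auto
    ultimately show ?case using ins T(2) insert.hyps by (metis card_insert_disjoint)
  qed
  from this[of \<S>] show ?thesis by auto
qed

end

section \<open>Graphs with many edges and no large packing\<close>

lemma real_choose_two: "real (k choose 2) = real k * (real k - 1) / 2"
  by (induction k) (simp_all add: numeral_2_eq_2 field_simps)

lemma card_fibre_ge:
  assumes "finite A" "finite D" "h ` A \<subseteq> D" "card D * c < card A"
  obtains g where "g \<in> D" "c < card {w\<in>A. h w = g}"
proof -
  have "card A = (\<Sum>g\<in>D. card {w\<in>A. h w = g})"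
    using assms(1-3) by (subst card_UN_disjoint[symmetric]) (auto intro!: arg_cong[where f = card])
  then have "\<not> (\<forall>g\<in>D. card {w\<in>A. h w = g} \<le> c)"
    using sum_bounded_above[of D "\<lambda>g. card {w\<in>A. h w = g}" c] assms(4) by auto
  then show ?thesis using that by force
qed

lemma sum_card_nbr_swap:
  assumes "finite A" "finite D"
  shows "(\<Sum>w\<in>D. card (nbr E w \<inter> A)) = (\<Sum>v\<in>A. card (nbr E v \<inter> D))"
proof -
  have c: "card (nbr E w \<inter> D') = (\<Sum>v\<in>D'. if {w, v} \<in> E then 1 else 0)" if "finite D'" for w D'
  proof -
    have "nbr E w \<inter> D' = {v\<in>D'. {w, v} \<in> E}" by (auto simp: nbr_def)
    then show ?thesis using that by (simp add: sum.If_cases Int_def)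
  qed
  have "(\<Sum>w\<in>D. card (nbr E w \<inter> A)) = (\<Sum>w\<in>D. \<Sum>v\<in>A. if {w, v} \<in> E then 1 else 0)"
    using c[OF assms(1)] by simp
  also have "\<dots> = (\<Sum>v\<in>A. \<Sum>w\<in>D. if {v, w} \<in> E then 1 else 0)"
    by (subst sum.swap) (simp add: insert_commute)
  finally show ?thesis using c[OF assms(2)] by simp
qed

text \<open>Integer form of the situation: bounding e below by 2 turns the constants 1024 and 12800
  of the theorem into 2048 and 25600. \<open>a\<close> is the size of the clique in the extremal
  construction, and \<open>C\<close> is the sample size of the pigeonhole argument. The choice of n0
  provides \<open>t_large\<close> and \<open>n_large\<close>.\<close>

locale dense_packing_free = covered_bipartite B s1 s2 W1 W2
  for B :: "'a set \<times> 'a set set" and s1 s2 :: nat and W1 W2 :: "'a set" +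
  fixes n t s C a :: nat and E :: "nat set set"
  assumes gE: "is_graph ({0..<n}, E)"
    and free: "\<not> contains_disjoint_copies ({0..<n}, E) (t + 1) B"
    and s_eq: "s = s1 + s2" and C_eq: "C = 32 * s * s1" and a_eq: "a + 1 = s1 * (t + 1)"
    and dense: "n choose 2 \<le> card E + ((n - a) choose 2)"
    and t_le: "2048 * s1 * s ^ 3 * t \<le> n"
    and t_sq: "32 * s1 * s * n \<le> t ^ 2"
    and ex_le: "25600 * s ^ 5 * ex_graph n B \<le> s1 * t * n"
    and t_large: "2000000 * s ^ 6 \<le> t"
    and n_large: "C * 2 ^ C * s2 < n"
begin

section \<open>Size estimates and common neighbours in L\<close>

definition V where "V = {0..<n}"

text \<open>The hypotheses leave room for a constant degree threshold: L should be the clique part of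
  the extremal graph, so its expected size is a.\<close>

definition L where "L = {v\<in>V. n \<le> 16 * s * card (nbr E v)}"

abbreviation M where "M \<equiv> card (missing V E L)"

lemma gV: "is_graph (V, E)" using gE by (simp add: V_def)

lemma freeV: "\<not> contains_disjoint_copies (V, E) (t + 1) B" using free by (simp add: V_def)

lemma finV: "finite V" and cardV: "card V = n" by (simp_all add: V_def)

lemma LV: "L \<subseteq> V" by (auto simp: L_def)

lemma finL: "finite L" using LV finV finite_subset by blast

lemma s_ge: "4 \<le> s" "2 * s1 \<le> s" "s1 \<le> s" "s2 + 2 \<le> s" "s2 \<le> s"
  using s1_ge s1_le s_eq by auto

lemma s_pow: "i \<le> j \<Longrightarrow> s ^ i \<le> s ^ j"
  using s_ge by (intro power_increasing) auto

lemma t_ge: "i \<le> 6 \<Longrightarrow> 2000000 * s ^ i \<le> t"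
  using s_pow[of i 6] t_large by linarith

lemma t_ge1: "2000000 * s \<le> t" using t_ge[of 1] by simp

lemma t_pos: "0 < t" using t_ge1 s_ge by linarith

lemma n_ge_t: "64 * s\<^sup>2 * t \<le> n" "256 * s * t \<le> n"
proof -
  have "1 * s ^ 2 \<le> s1 * s ^ 3" using s1_ge s_pow[of 2 3] by (intro mult_mono) auto
  then have "64 * s\<^sup>2 * t \<le> 2048 * (s1 * s ^ 3) * t" by (intro mult_right_mono) auto
  also have "\<dots> = 2048 * s1 * s ^ 3 * t" by simp
  also have "\<dots> \<le> n" by (rule t_le)
  finally show 1: "64 * s\<^sup>2 * t \<le> n" .
  have "4 * s * t \<le> s\<^sup>2 * t" using s_ge(1) by (simp add: power2_eq_square)
  then show "256 * s * t \<le> n" using 1 by linarith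
qed

lemma C_small: "C \<le> 16 * s\<^sup>2" "C \<le> t"
proof -
  have "C = 16 * s * (2 * s1)" unfolding C_eq by simp
  also have "\<dots> \<le> 16 * s * s" using s_ge(2) by (rule mult_left_mono) simp
  finally show 1: "C \<le> 16 * s\<^sup>2" by (simp add: power2_eq_square)
  then show "C \<le> t" using t_ge[of 2] by simp
qed

lemma n_pos: "0 < n" using n_large by simp

text \<open>The vertices of t + 1 copies and C spare ones number at most n / (32 s), half the degree
  that defines \<open>L\<close>; avoiding them leaves each vertex of \<open>L\<close> at least n /
  (32 s) neighbours.\<close>

lemma avoid_small: "32 * s * (s * (t + 1) + C) \<le> n"
proof -
  have "s * (t + 1) + C \<le> s * (t + 1 + 16 * s)"
    using C_small(1) by (simp add: power2_eq_square algebra_simps)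
  also have "\<dots> \<le> s * (2 * t)" using t_ge1 s_ge by (intro mult_left_mono) auto
  finally have "32 * s * (s * (t + 1) + C) \<le> 32 * s * (s * (2 * t))" by (rule mult_left_mono) simp
  also have "\<dots> = 64 * s\<^sup>2 * t" by (simp add: power2_eq_square)
  finally show ?thesis using n_ge_t(1) by linarith
qed

text \<open>Any C vertices of L already span the small side of a complete bipartite graph, hence the
  vertices of L can be used up greedily, s1 at a time, until at most C of them are left.\<close>

lemma common_nbrs_pigeonhole:
  assumes L': "L' \<subseteq> L" "C \<le> card L'" and X: "X \<subseteq> V" "32 * s * card X \<le> n"
  shows "\<exists>g\<subseteq>L'. \<exists>Y\<subseteq>V - X. card g = s1 \<and> card Y = s2 \<and> (\<forall>x\<in>g. \<forall>y\<in>Y. {x, y} \<in> E)"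
proof -
  obtain A where A: "A \<subseteq> L'" "card A = C" using L'(2) by (meson obtain_subset_with_card_n)
  have finA: "finite A" using A(1) L'(1) finL by (meson finite_subset)
  have finX: "finite (V - X)" using finV by simp
  have deg: "n \<le> 32 * s * card (nbr E v \<inter> (V - X))" if "v \<in> A" for v
  proof -
    have "nbr E v \<inter> (V - X) = nbr E v - X" using nbr_subset[OF gV] by blast
    then have "card (nbr E v) \<le> card (nbr E v \<inter> (V - X)) + card X"
      using card_Diff_subset_Int[of "nbr E v" X] finite_nbr[OF gV]
      by (metis X(1) diff_card_le_card_Diff finV finite_subset le_diff_conv)
    then have "32 * s * card (nbr E v) \<le> 32 * s * (card (nbr E v \<inter> (V - X)) + card X)"
      by (rule mult_left_mono) simp
    moreover have "n \<le> 16 * s * card (nbr E v)" using that A L' by (auto simp: L_def)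
    ultimately show ?thesis using X(2) by (simp add: algebra_simps)
  qed
  let ?S = "\<Sum>w\<in>V - X. card (nbr E w \<inter> A)"
  \<comment> \<open>C vertices with n / (32 s) neighbours each give s1 n incidences; this is the
    reason for C = 32 s s1.\<close>
  have "C * n \<le> (\<Sum>v\<in>A. 32 * s * card (nbr E v \<inter> (V - X)))"
    using sum_bounded_below[of A n "\<lambda>v. 32 * s * card (nbr E v \<inter> (V - X))"] deg A(2) by simp
  also have "\<dots> = 32 * s * ?S"
    by (simp add: sum_card_nbr_swap[OF finA finX] sum_distrib_left)
  finally have "32 * s * (s1 * n) \<le> 32 * s * ?S" unfolding C_eq by (simp add: mult.assoc)
  then have S_ge: "s1 * n \<le> ?S" using s_ge by simp
  define D where "D = {w\<in>V - X. s1 \<le> card (nbr E w \<inter> A)}"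
  have finD: "finite D" using finV by (simp add: D_def)
  \<comment> \<open>Vertices outside \<open>D\<close> contribute at most s1 - 1 each, too little to
    reach s1 n, so \<open>D\<close> has at least n / C vertices.\<close>
  have "?S \<le> (\<Sum>w\<in>V - X. (s1 - 1) + (if w \<in> D then C else 0))"
  proof (rule sum_mono)
    fix w assume w: "w \<in> V - X"
    have "card (nbr E w \<inter> A) \<le> C" using A(2) finA by (metis card_mono inf_le2)
    then show "card (nbr E w \<inter> A) \<le> (s1 - 1) + (if w \<in> D then C else 0)"
      using w by (auto simp: D_def)
  qed
  also have "\<dots> = card (V - X) * (s1 - 1) + C * card D"
    using finX by (simp add: sum.distrib sum.If_cases D_def Int_def)
  also have "\<dots> \<le> n * (s1 - 1) + C * card D"
    using card_mono[OF finV, of "V - X"] cardV by (intro add_right_mono mult_right_mono) auto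
  finally have "s1 * n \<le> n * (s1 - 1) + C * card D" using S_ge by linarith
  moreover have "s1 * n = n * (s1 - 1) + n" using s1_ge by (cases s1) auto
  ultimately have nD: "n \<le> C * card D" by linarith
  have "\<exists>g. g \<subseteq> nbr E w \<inter> A \<and> card g = s1" if "w \<in> D" for w
    using that unfolding D_def by (metis (mono_tags, lifting) mem_Collect_eq obtain_subset_with_card_n)
  then obtain h where h: "\<And>w. w \<in> D \<Longrightarrow> h w \<subseteq> nbr E w \<inter> A \<and> card (h w) = s1" by metis
  \<comment> \<open>Each vertex of \<open>D\<close> selects an s1-set among the 2^C subsets of
    \<open>A\<close>; \<open>n_large\<close> forces more than s2 of them to select the same
    one.\<close>
  have "C * (2 ^ C * s2) < C * card D" using nD n_large unfolding mult.assoc by linarith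
  then have "2 ^ C * s2 < card D" by simp
  then have "card (Pow A) * s2 < card D" using A(2) finA by (simp add: card_Pow)
  moreover have "h ` D \<subseteq> Pow A" using h by blast
  ultimately obtain g where g: "g \<in> Pow A" "s2 < card {w\<in>D. h w = g}"
    using card_fibre_ge[OF finD _ _, of "Pow A" h s2] finA by auto
  then obtain Y where Y: "Y \<subseteq> {w\<in>D. h w = g}" "card Y = s2"
    by (meson less_imp_le obtain_subset_with_card_n)
  have "{w\<in>D. h w = g} \<noteq> {}" using g(2) by force
  then have "card g = s1" using h by blast
  moreover have "\<forall>x\<in>g. \<forall>y\<in>Y. {x, y} \<in> E"
  proof (intro ballI)
    fix x y assume "x \<in> g" "y \<in> Y"
    then have "x \<in> nbr E y" using h Y by blast
    then show "{x, y} \<in> E" by (simp add: nbr_def insert_commute)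
  qed
  moreover have "Y \<subseteq> V - X" using Y by (auto simp: D_def)
  moreover have "g \<subseteq> L'" using g A by auto
  ultimately show ?thesis using Y(2) by blast
qed

section \<open>First bounds on L, the missing pairs and the edges outside L\<close>

lemma host_card: "hosts (V, E) B S \<Longrightarrow> card S = s"
  using hosts_card[of "(V, E)" B S] card_B s_eq by simp

lemma packing_extend_false:
  assumes "packing (hosts (V, E) B) \<S>" "packing (hosts (V, E) B) \<T>"
    "\<Union>\<T> \<inter> \<Union>\<S> = {}" "card \<S> + card \<T> = t + 1"
  shows False
proof -
  have ne: "\<And>S. hosts (V, E) B S \<Longrightarrow> S \<noteq> {}" using hosts_nonempty B_nonempty by blast
  have "packing (hosts (V, E) B) (\<S> \<union> \<T>)" "card (\<S> \<union> \<T>) = t + 1"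
    using packing_Un[OF assms(1,2) _ ne] assms(3,4) by (auto simp: Int_commute)
  then show False using packing_hosts_imp_disjoint_copies freeV by blast
qed

text \<open>Copies outside \<open>L\<close> and copies grown from groups of s1 vertices of
  \<open>L\<close> would add up to t + 1 disjoint ones. The C spare vertices keep the pigeonhole
  step available up to the last group.\<close>

lemma card_L_less:
  assumes S: "packing (\<lambda>S. hosts (V, E) B S \<and> S \<subseteq> V - L) \<S>" "card \<S> \<le> t + 1"
  shows "card L < C + s1 * (t + 1 - card \<S>)"
proof (rule ccontr)
  assume large: "\<not> ?thesis"
  define q where "q = t + 1 - card \<S>"
  have "C + s1 * q \<le> card L" using large unfolding q_def by simp
  then obtain L' where L': "L' \<subseteq> L" "card L' = C + s1 * q"
    by (meson obtain_subset_with_card_n)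
  have P: "\<Union>\<S> \<subseteq> V - L" using S by (auto simp: packing_def)
  have pk: "packing (hosts (V, E) B) \<S>" using packing_mono[OF S(1)] by blast
  have "card (\<Union>\<S>) \<le> card \<S> * s"
    by (rule card_Union_packing_le[OF pk]) (auto dest: host_card)
  then have "card (\<Union>\<S> \<union> L') \<le> card \<S> * s + (C + s1 * q)"
    using card_Un_le[of "\<Union>\<S>" L'] L'(2) by linarith
  moreover have "card \<S> * s + s * q = s * (t + 1)"
    using S(2) unfolding q_def by (metis add_mult_distrib2 le_add_diff_inverse mult.commute)
  moreover have "s * q = s1 * q + s2 * q" by (simp add: s_eq algebra_simps)
  ultimately have N: "card (\<Union>\<S> \<union> L') + s2 * q \<le> s * (t + 1) + C" by linarith
  have "\<exists>\<T>. packing (hosts (V, E) B) \<T> \<and> card \<T> = q \<and> \<Union>\<T> \<inter> \<Union>\<S> = {}"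
  proof (rule greedy_packing[OF gV LV, of "\<lambda>q L'. C + s1 * q \<le> card L'"])
    fix q L' X assume a: "L' \<subseteq> L" "C + s1 * Suc q \<le> card L'" "X \<subseteq> V" "card X + s2 \<le> s * (t + 1) + C"
    have "32 * s * card X \<le> 32 * s * (s * (t + 1) + C)" using a(4) by (intro mult_left_mono) auto
    then have "32 * s * card X \<le> n" using avoid_small by linarith
    with common_nbrs_pigeonhole[OF a(1) _ a(3)] a(2)
    obtain g Y where g: "g \<subseteq> L'" "Y \<subseteq> V - X" "card g = s1" "card Y = s2" "\<forall>x\<in>g. \<forall>y\<in>Y. {x, y} \<in> E"
      by (metis add_leD1)
    have "finite g" using g(1) a(1) finL by (meson finite_subset)
    then have "C + s1 * q \<le> card (L' - g)" using a(2) g(1,3) by (simp add: card_Diff_subset)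
    then show "\<exists>g\<subseteq>L'. \<exists>Y\<subseteq>V - X. card g = s1 \<and> card Y = s2 \<and> (\<forall>x\<in>g. \<forall>y\<in>Y. {x, y} \<in> E)
        \<and> C + s1 * q \<le> card (L' - g)" using g by blast
  qed (use L' P N in auto)
  then obtain \<T> where T: "packing (hosts (V, E) B) \<T>" "card \<T> = q" "\<Union>\<T> \<inter> \<Union>\<S> = {}" by blast
  have "card \<S> + card \<T> = t + 1" using T(2) S(2) unfolding q_def by simp
  then show False using packing_extend_false[OF pk T(1,3)] by blast
qed

text \<open>Since n div |A| is at least n / (2 |A|), repeating the free part makes the first bound
  proportional to |A|. That matters when \<open>A\<close> lies in the small set
  \<open>U\<close>.\<close>

lemma free_part:
  assumes A: "A \<subseteq> V" "\<And>S. hosts (V, E) B S \<Longrightarrow> \<not> S \<subseteq> A"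
  shows "card (edges_in E A) * n \<le> 2 * card A * ex_graph n B" "card (edges_in E A) \<le> ex_graph n B"
proof -
  have finA: "finite A" using A(1) finV by (meson finite_subset)
  have "card (edges_in E A) * n \<le> 2 * card A * ex_graph n B \<and> card (edges_in E A) \<le> ex_graph n B"
  proof (cases "A = {}")
    case True
    have "edges_in E {} = {}" using gV by (fastforce simp: edges_in_def is_graph_def)
    then show ?thesis using True by simp
  next
    case False
    define u where "u = card A"
    have u: "0 < u" "u \<le> n"
      using False finA card_mono[OF finV A(1)] cardV by (auto simp: u_def card_gt_0_iff)
    have g: "is_graph (A, edges_in E A)" using gV finA by (auto simp: is_graph_def edges_in_def)
    have "\<not> contains_copy (A, edges_in E A) B"
    proof
      assume "contains_copy (A, edges_in E A) B"
      then obtain f where f: "embedding f B (A, edges_in E A)" by (auto simp: contains_copy_def)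
      then have "embedding f B (V, E)" using A(1) by (auto simp: embedding_def edges_in_def)
      then show False using A(2)[of "f ` fst B"] f by (auto simp: hosts_def embedding_def)
    qed
    from ex_graph_superadditive[OF conn no_isolated graph g u_def[symmetric] u(1) this]
    have ex: "card (edges_in E A) * (n div u) \<le> ex_graph n B" .
    have q: "1 \<le> n div u" using u by (simp add: div_greater_zero_iff Suc_le_eq)
    have "n < u * (n div u) + u" using mult_div_mod_eq[of u n] mod_less_divisor[OF u(1), of n] by linarith
    moreover have "u * 1 \<le> u * (n div u)" using q by (rule mult_left_mono) simp
    ultimately have "n \<le> 2 * u * (n div u)" by linarith
    then have "card (edges_in E A) * n \<le> card (edges_in E A) * (2 * u * (n div u))" by (rule mult_left_mono) simp
    also have "\<dots> = 2 * u * (card (edges_in E A) * (n div u))" by simp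
    also have "\<dots> \<le> 2 * u * ex_graph n B" using ex by (rule mult_left_mono) simp
    finally have 1: "card (edges_in E A) * n \<le> 2 * u * ex_graph n B" .
    have "card (edges_in E A) * 1 \<le> card (edges_in E A) * (n div u)" using q by (rule mult_left_mono) simp
    then have "card (edges_in E A) \<le> ex_graph n B" using ex by linarith
    then show ?thesis using 1 by (simp add: u_def)
  qed
  then show "card (edges_in E A) * n \<le> 2 * card A * ex_graph n B" "card (edges_in E A) \<le> ex_graph n B"
    by auto
qed

lemma card_edges_outside_L:
  assumes "finite R" "R \<inter> L = {}" "card R \<le> k * s"
  shows "16 * card (edges_in E (V - L)) \<le> 16 * card (edges_in E (V - L - R)) + k * n"
proof -
  have "16 * s * card (nbr E v) \<le> n" if "v \<in> R" for v
  proof (cases "v \<in> V")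
    case True
    then show ?thesis using that assms(2) by (auto simp: L_def)
  next
    case False
    then have "nbr E v = {}" using gV by (auto simp: nbr_def is_graph_def)
    then show ?thesis by simp
  qed
  from card_edges_in_remove[OF gV assms(1) this]
  have "16 * s * card (edges_in E (V - L)) \<le> 16 * s * card (edges_in E (V - L - R)) + card R * n" .
  moreover have "card R * n \<le> k * s * n" using assms(3) by (rule mult_right_mono) simp
  ultimately have "16 * s * card (edges_in E (V - L)) \<le> 16 * s * card (edges_in E (V - L - R)) + k * s * n"
    by linarith
  then have "s * (16 * card (edges_in E (V - L))) \<le> s * (16 * card (edges_in E (V - L - R)) + k * n)"
    by (simp add: algebra_simps)
  then show ?thesis using s_ge by simp
qed

text \<open>\<open>j\<close> is the size of a maximal packing of copies outside \<open>L\<close>: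
  deleting it leaves a B-free graph, and \<open>card_L_less\<close> trades its size against
  |L|.\<close>

lemma outside_L_first_bound:
  "\<exists>j. s1 * j + card L < s1 * (t + 1) + C \<and>
    16 * card (edges_in E (V - L)) \<le> 16 * ex_graph n B + j * n"
proof -
  let ?Q = "\<lambda>S. hosts (V, E) B S \<and> S \<subseteq> V - L"
  have ne: "S \<noteq> {}" if "?Q S" for S using that hosts_nonempty B_nonempty by blast
  have no: "\<not> (packing ?Q \<S> \<and> card \<S> = t + 1)" for \<S>
    using packing_extend_false[of \<S> "{}"] packing_mono[of ?Q \<S> "hosts (V, E) B"] by auto
  then obtain \<S> where S: "packing ?Q \<S>" "card \<S> < t + 1" "\<forall>S. ?Q S \<longrightarrow> S \<inter> \<Union>\<S> \<noteq> {}"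
    using packing_or_maximal[of ?Q "t + 1"] ne by blast
  have cR: "card (\<Union>\<S>) \<le> card \<S> * s"
    by (rule card_Union_packing_le[OF S(1)]) (auto dest: host_card)
  have R: "\<Union>\<S> \<subseteq> V - L" using S by (auto simp: packing_def)
  then have fR: "finite (\<Union>\<S>)" using finV by (meson finite_Diff finite_subset)
  have "card (edges_in E (V - L - \<Union>\<S>)) \<le> ex_graph n B"
  proof (rule free_part)
    fix S assume "hosts (V, E) B S"
    moreover have "S \<noteq> {}" using calculation hosts_nonempty B_nonempty by blast
    ultimately show "\<not> S \<subseteq> V - L - \<Union>\<S>" using S(3) by blast
  qed auto
  moreover have "16 * card (edges_in E (V - L)) \<le> 16 * card (edges_in E (V - L - \<Union>\<S>)) + card \<S> * n"
    using card_edges_outside_L[OF fR _ cR] R by blast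
  moreover have "s1 * card \<S> + card L < s1 * (t + 1) + C"
  proof -
    have "s1 * (t + 1 - card \<S>) + s1 * card \<S> = s1 * (t + 1)"
      using S(2) by (metis add_mult_distrib2 le_add_diff_inverse2 less_imp_le)
    then show ?thesis using card_L_less[OF S(1)] S(2) by linarith
  qed
  ultimately show ?thesis by (intro exI[of _ "card \<S>"]) linarith
qed

abbreviation eO where "eO \<equiv> card (edges_in E (V - L))"

lemma card_L_le: "card L \<le> a + C"
  using outside_L_first_bound a_eq by auto

lemma a_small: "4 * (a + card L + 1) \<le> n"
proof -
  define w where "w = s * t"
  have "a + 1 \<le> s * (2 * t)" unfolding a_eq using s_ge t_pos by (intro mult_mono) auto
  then have "a + 1 \<le> 2 * w" by (simp add: w_def)
  moreover have "t \<le> w" using s_ge by (simp add: w_def)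
  moreover have "256 * w \<le> n" using n_ge_t(2) by (simp add: w_def)
  ultimately show ?thesis using card_L_le C_small(2) t_pos by simp
qed

text \<open>The density assumption inserted into the edge identity. The difference of the two
  binomials factors, and over the reals |L| - a may have either sign.\<close>

lemma missing_eq_le:
  "real M \<le> real eO + (real (card L) - a) * ((2 * real n - a - card L - 1) / 2)"
proof -
  have c: "card (V - L) = n - card L" using LV finL cardV by (simp add: card_Diff_subset)
  have "M + ((n - card L) choose 2) \<le> ((n - a) choose 2) + eO"
    using card_edges_missing[OF gV LV] dense unfolding c cardV by linarith
  then have "real M + real ((n - card L) choose 2) \<le> real ((n - a) choose 2) + real eO"
    by linarith
  moreover have "real (n - card L) = real n - card L" "real (n - a) = real n - a"
    using a_small by auto
  ultimately have "real M \<le> real eO + ((real n - a) * (real n - a - 1) / 2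
      - (real n - card L) * (real n - card L - 1) / 2)"
    unfolding real_choose_two by simp
  also have "(real n - a) * (real n - a - 1) / 2 - (real n - card L) * (real n - card L - 1) / 2
    = (real (card L) - a) * ((2 * real n - a - card L - 1) / 2)"
    by (simp add: field_simps)
  finally show ?thesis .
qed

lemma missing_le1:
  assumes "card L \<le> a"
  shows "real M + 3 / 4 * (real (a - card L) * n) \<le> real eO"
proof -
  have "real (a - card L) * (3 / 4 * n) \<le> real (a - card L) * ((2 * real n - a - card L - 1) / 2)"
    using a_small by (intro mult_left_mono) auto
  moreover have eq: "real (card L) - a = - real (a - card L)" using assms by simp
  ultimately show ?thesis using missing_eq_le unfolding eq mult_minus_left by linarith
qed

lemma missing_le2:
  assumes "a \<le> card L"
  shows "real M \<le> real eO + real (card L - a) * n"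
proof -
  have "real (card L - a) * ((2 * real n - a - card L - 1) / 2) \<le> real (card L - a) * n"
    by (intro mult_left_mono) auto
  moreover have eq: "real (card L) - a = real (card L - a)" using assms by simp
  ultimately show ?thesis using missing_eq_le unfolding eq by linarith
qed

lemma ex_small: "25600 * s ^ 4 * ex_graph n B \<le> t * n"
proof -
  have "s * (25600 * s ^ 4 * ex_graph n B) = 25600 * s ^ 5 * ex_graph n B"
    by (simp add: power_Suc[symmetric] del: power_Suc)
  also have "\<dots> \<le> s1 * t * n" by (rule ex_le)
  also have "\<dots> \<le> s * t * n" using s_ge(3) by (intro mult_right_mono) auto
  finally have "s * (25600 * s ^ 4 * ex_graph n B) \<le> s * (t * n)" by (simp add: mult.assoc)
  then show ?thesis using s_ge by simp
qed

lemma C_small_t: "25600 * s ^ 4 * (1 + 2 * C) \<le> t"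
proof -
  have "1 \<le> s\<^sup>2" using s_ge by simp
  then have "1 + 2 * C \<le> 33 * s\<^sup>2" using C_small(1) by linarith
  then have "25600 * s ^ 4 * (1 + 2 * C) \<le> 25600 * s ^ 4 * (33 * s\<^sup>2)" by (rule mult_left_mono) simp
  also have "\<dots> = 844800 * s ^ 6" by (simp add: power_add[symmetric])
  finally show ?thesis using t_large by linarith
qed

text \<open>The number \<open>j\<close> of copies outside \<open>L\<close> exceeds the deficit a -
  |L| by at most C, so their j n / 16 edges are mostly absorbed by the 3/4 (a - |L|) n of
  \<open>missing_le1\<close>. What remains is ex(n, B) plus O(C n), and the lower bounds on t make
  both a small part of t n.\<close>

lemma first_bounds: "12800 * s ^ 4 * M \<le> t * n" "6400 * s ^ 4 * (a - card L) \<le> t"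
proof -
  obtain j where j: "s1 * j + card L < s1 * (t + 1) + C" "16 * eO \<le> 16 * ex_graph n B + j * n"
    using outside_L_first_bound by blast
  have "2 * j \<le> s1 * j" using s1_ge by (rule mult_right_mono) simp
  then have jl: "j + card L < a + 1 + C" using j(1) a_eq by linarith
  let ?x = "real (a - card L)" and ?ex = "real (ex_graph n B)"
  have eO: "real eO \<le> ?ex + real j * n / 16"
  proof -
    have "real (16 * eO) \<le> real (16 * ex_graph n B + j * n)" using j(2) by linarith
    then show ?thesis by simp
  qed
  define k where "k = real n + 2 * (real C * real n)"
  have nn: "0 \<le> ?x * n" "0 \<le> real C * real n" "0 \<le> real n" "0 \<le> real M" "0 \<le> ?ex" by simp_all
  have main: "real M \<le> ?ex + k \<and> ?x * n / 2 \<le> ?ex + k"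
  proof (cases "card L \<le> a")
    case True
    then have "real j \<le> ?x + 1 + C" using jl by linarith
    then have "real j * n \<le> (?x + 1 + C) * n" by (rule mult_right_mono) simp
    then have "real j * n \<le> ?x * n + n + real C * real n" by (simp add: distrib_right)
    then have "real M + ?x * n / 2 \<le> ?ex + k"
      using missing_le1[OF True] eO nn unfolding k_def by linarith
    then show ?thesis using nn by linarith
  next
    case False
    then have "real (card L - a) \<le> C" using card_L_le by linarith
    then have "real (card L - a) * n \<le> real C * real n" by (rule mult_right_mono) simp
    moreover have "real j \<le> C" using False jl by linarith
    then have "real j * n \<le> real C * real n" by (rule mult_right_mono) simp
    moreover have "real M \<le> real eO + real (card L - a) * n" using missing_le2 False by simp
    ultimately have "real M \<le> ?ex + k" using eO nn unfolding k_def by linarith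
    moreover have "?x * n / 2 = 0" using False by simp
    ultimately show ?thesis using nn unfolding k_def by linarith
  qed
  have S: "0 \<le> 12800 * real s ^ 4" by simp
  have e: "12800 * real s ^ 4 * ?ex \<le> real t * n / 2"
  proof -
    have "real (25600 * s ^ 4 * ex_graph n B) \<le> real (t * n)" using ex_small by linarith
    then show ?thesis by simp
  qed
  have c: "12800 * real s ^ 4 * k \<le> real t * n / 2"
  proof -
    have "25600 * s ^ 4 * (1 + 2 * C) * n \<le> t * n" using C_small_t by (rule mult_right_mono) simp
    then have "real (25600 * s ^ 4 * (1 + 2 * C) * n) \<le> real (t * n)" by (rule of_nat_mono)
    then show ?thesis by (simp add: k_def algebra_simps)
  qed
  have sum: "12800 * real s ^ 4 * (?ex + k) \<le> real t * n"
    using e c unfolding distrib_left by linarith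
  have "12800 * real s ^ 4 * M \<le> real t * n"
    using mult_left_mono[OF conjunct1[OF main] S] sum by linarith
  then have "real (12800 * s ^ 4 * M) \<le> real (t * n)" by simp
  then show "12800 * s ^ 4 * M \<le> t * n" by linarith
  have "12800 * real s ^ 4 * (?x * n / 2) \<le> real t * n"
    using mult_left_mono[OF conjunct2[OF main] S] sum by linarith
  then have "6400 * real s ^ 4 * ?x * n \<le> real t * n" by (simp add: mult_ac)
  then have "6400 * real s ^ 4 * ?x \<le> real t" using n_pos by simp
  then have "real (6400 * s ^ 4 * (a - card L)) \<le> real t" by simp
  then show "6400 * s ^ 4 * (a - card L) \<le> t" by linarith
qed

text \<open>Threshold n / (32 s s1): s1 - 1 vertices of \<open>L\<close> that are not bad jointly
  miss less than n / (32 s) vertices, which is what the neighbourhood of any vertex of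
  \<open>L\<close> retains after the used vertices are avoided.\<close>

definition bad where "bad = {v\<in>L. n < 32 * s * s1 * (n - card (nbr E v))}"

lemma card_bad: "100 * card bad \<le> t"
proof -
  have "card bad * n \<le> 2 * (64 * s * s1) * M"
  proof (rule card_missing_ge[OF finV, where f = "\<lambda>v. V - nbr E v - {v}"])
    fix v assume v: "v \<in> bad"
    then have vV: "v \<in> V" using LV by (auto simp: bad_def)
    have "v \<notin> nbr E v" using nbr_subset[OF gV] by blast
    then have "card (V - nbr E v - {v}) = n - card (nbr E v) - 1"
      using vV cardV nbr_subset[OF gV, of v] finite_nbr[OF gV, of v] finV
      by (simp add: card_Diff_subset subset_Diff_insert)
    \<comment> \<open>Doubling 32 to 64 pays for \<open>v\<close> itself, which n - deg(v) counts as
      a non-neighbour.\<close>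
    then have "64 * s * s1 * (n - card (nbr E v)) \<le> 64 * s * s1 * (card (V - nbr E v - {v}) + 1)"
      by (intro mult_left_mono) auto
    moreover have "n < 32 * s * s1 * (n - card (nbr E v))" using v by (simp add: bad_def)
    moreover have "64 * s * s1 \<le> n"
    proof -
      have "64 * s * s1 \<le> 64 * s * t" using s_ge(3) t_ge1 by (intro mult_left_mono) auto
      then show ?thesis using n_ge_t(2) by linarith
    qed
    ultimately show "n \<le> 64 * s * s1 * card (V - nbr E v - {v})" by (simp add: algebra_simps)
  qed (use LV in \<open>auto simp: bad_def\<close>)
  also have "\<dots> \<le> 128 * s ^ 4 * M"
  proof -
    have "s * s1 \<le> s * s" using s_ge by simp
    also have "\<dots> \<le> s ^ 4" using s_pow[of 2 4] by (simp add: power2_eq_square)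
    finally have "128 * (s * s1) * M \<le> 128 * s ^ 4 * M" by (intro mult_right_mono mult_left_mono) auto
    then show ?thesis by (simp add: mult.assoc)
  qed
  finally have "100 * (card bad * n) \<le> 12800 * s ^ 4 * M" by linarith
  also have "\<dots> \<le> t * n" by (rule first_bounds(1))
  finally have "100 * card bad * n \<le> t * n" by simp
  then show ?thesis using n_pos by simp
qed

text \<open>A vertex of L that is not almost full still has many common neighbours with s1 - 1 almost
  full ones. Spreading the few bad vertices over different copies uses up L without remainder.\<close>

lemma common_nbrs_good:
  assumes g: "b \<in> L" "T \<subseteq> L - bad" "card T = s1 - 1" and X: "X \<subseteq> V" "card X + s2 \<le> s * (t + 1) + C"
  shows "\<exists>Y\<subseteq>V - X. card Y = s2 \<and> (\<forall>x\<in>insert b T. \<forall>y\<in>Y. {x, y} \<in> E)"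
proof -
  define D where "D = (\<Union>v\<in>T. V - nbr E v)"
  define W where "W = nbr E b - X - D"
  have finT: "finite T" using g(2) finL by (meson finite_Diff finite_subset)
  have "card D \<le> (\<Sum>v\<in>T. card (V - nbr E v))" unfolding D_def by (rule card_UN_le[OF finT])
  then have "32 * s * s1 * card D \<le> (\<Sum>v\<in>T. 32 * s * s1 * card (V - nbr E v))"
    by (metis mult_le_mono2 sum_distrib_left)
  also have "\<dots> \<le> of_nat (card T) * n"
  proof (rule sum_bounded_above)
    fix v assume v: "v \<in> T"
    have "card (V - nbr E v) = n - card (nbr E v)"
      using cardV nbr_subset[OF gV, of v] finite_nbr[OF gV, of v] by (subst card_Diff_subset) auto
    then show "32 * s * s1 * card (V - nbr E v) \<le> n" using v g(2) by (auto simp: bad_def)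
  qed
  finally have cD: "32 * s * s1 * card D \<le> (s1 - 1) * n" using g(3) by simp
  have "nbr E b \<subseteq> W \<union> (X \<union> D)" by (auto simp: W_def)
  moreover have "finite (W \<union> (X \<union> D))"
    using finite_nbr[OF gV] X(1) finV finT by (auto simp: W_def D_def intro: finite_subset)
  ultimately have "card (nbr E b) \<le> card (W \<union> (X \<union> D))" by (rule card_mono[rotated])
  also have "\<dots> \<le> card W + (card X + card D)" by (meson add_left_mono card_Un_le le_trans)
  finally have "32 * s * s1 * card (nbr E b) \<le> 32 * s * s1 * (card W + (card X + card D))"
    by (rule mult_left_mono) simp
  then have 1: "32 * s * s1 * card (nbr E b)
      \<le> 32 * s * s1 * card W + 32 * s * s1 * card X + 32 * s * s1 * card D"
    by (simp add: distrib_left)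
  have "n \<le> 16 * s * card (nbr E b)" using g(1) by (simp add: L_def)
  then have "2 * s1 * n \<le> 2 * s1 * (16 * s * card (nbr E b))" by (rule mult_left_mono) simp
  then have 2: "2 * s1 * n \<le> 32 * s * s1 * card (nbr E b)" by (simp add: mult_ac)
  have "32 * s * (card X + s2) \<le> 32 * s * (s * (t + 1) + C)" using X(2) by (rule mult_left_mono) simp
  also have "\<dots> \<le> n" by (rule avoid_small)
  finally have "s1 * (32 * s * (card X + s2)) \<le> s1 * n" by (rule mult_left_mono) simp
  then have 3: "32 * s * s1 * card X + 32 * s * s1 * s2 \<le> s1 * n" by (simp add: algebra_simps)
  have "(s1 - 1) * n \<le> s1 * n" by simp
  then have "32 * s * s1 * s2 \<le> 32 * s * s1 * card W" using 1 2 3 cD by linarith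
  then have "s2 \<le> card W" using s_ge(1) s1_ge by simp
  then obtain Y where Y: "Y \<subseteq> W" "card Y = s2" by (meson obtain_subset_with_card_n)
  have WV: "W \<subseteq> V - X" using nbr_subset[OF gV, of b] by (auto simp: W_def)
  have "{x, y} \<in> E" if "x \<in> insert b T" "y \<in> Y" for x y
  proof -
    have "y \<in> nbr E x"
    proof (cases "x = b")
      case True
      then show ?thesis using that Y by (auto simp: W_def)
    next
      case False
      then have "x \<in> T" using that by simp
      then show ?thesis using that(2) Y(1) WV by (auto simp: W_def D_def)
    qed
    then show ?thesis by (simp add: nbr_def)
  qed
  then show ?thesis using Y WV by (metis subset_trans)
qed

text \<open>The given copies occupy at most |\<S>| (s1 - 1) vertices of \<open>L\<close>, so at
  least s1 (t + 1 - |\<S>|) are left, exactly what the remaining copies need. More than t / 2 groups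
  are formed and at most t / 100 vertices are bad, hence one bad vertex per group suffices. The
  empty \<S> already yields |L| \<le> a.\<close>

lemma extension_false:
  assumes S: "packing (hosts (V, E) B) \<S>" "2 * card \<S> \<le> t"
    and L: "card (\<Union>\<S> \<inter> L) \<le> card \<S> * (s1 - 1)" "a + 1 \<le> card \<S> + card L"
  shows False
proof -
  define q where "q = t + 1 - card \<S>"
  have qp: "card \<S> + q = t + 1" using S(2) by (simp add: q_def)
  have "card \<S> * s1 + s1 * q = s1 * (t + 1)" unfolding qp[symmetric] by (simp add: algebra_simps)
  moreover have "card \<S> * (s1 - 1) + card \<S> = card \<S> * s1" using s1_ge by (cases s1) auto
  moreover have "card L = card (L - \<Union>\<S>) + card (\<Union>\<S> \<inter> L)"
    using finL card_Diff_subset_Int[of L "\<Union>\<S>"] card_mono[OF finL, of "\<Union>\<S> \<inter> L"] by (simp add: Int_commute)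
  ultimately have "s1 * q \<le> card (L - \<Union>\<S>)" using L a_eq by linarith
  then obtain L' where L': "L' \<subseteq> L - \<Union>\<S>" "card L' = s1 * q" by (meson obtain_subset_with_card_n)
  have PV: "\<Union>\<S> \<subseteq> V" using S(1) hosts_subset by (fastforce simp: packing_def)
  have "card (\<Union>\<S>) \<le> card \<S> * s"
    by (rule card_Union_packing_le[OF S(1)]) (auto dest: host_card)
  then have "card (\<Union>\<S> \<union> L') + s2 * q \<le> card \<S> * s + s * q"
    using card_Un_le[of "\<Union>\<S>" L'] L'(2) s_eq by (simp add: algebra_simps)
  also have "\<dots> = s * (t + 1)" unfolding qp[symmetric] by (simp add: algebra_simps)
  finally have N: "card (\<Union>\<S> \<union> L') + s2 * q \<le> s * (t + 1) + C" by linarith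
  have finb: "finite bad" using finL by (simp add: bad_def)
  have bq: "card (L' \<inter> bad) \<le> q"
    using card_mono[OF finb, of "L' \<inter> bad"] card_bad S(2) qp by simp
  have "\<exists>\<T>. packing (hosts (V, E) B) \<T> \<and> card \<T> = q \<and> \<Union>\<T> \<inter> \<Union>\<S> = {}"
  proof (rule greedy_packing[OF gV LV, of "\<lambda>q L'. card L' = s1 * q \<and> card (L' \<inter> bad) \<le> q"])
    fix q L' X
    assume h: "L' \<subseteq> L" "card L' = s1 * Suc q \<and> card (L' \<inter> bad) \<le> Suc q"
      "X \<subseteq> V" "card X + s2 \<le> s * (t + 1) + C"
    have finL': "finite L'" using h(1) finL by (meson finite_subset)
    have "s1 * Suc q = (s1 - 1) + Suc ((s1 - 1) * q + q)" using s1_ge by (cases s1) auto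
    then have cL': "card L' = (s1 - 1) + Suc ((s1 - 1) * q + q)" using h(2) by simp
    have cg: "card L' = card (L' - bad) + card (L' \<inter> bad)"
      using finL' card_Diff_subset_Int[of L' bad] card_mono[OF finL', of "L' \<inter> bad"] by simp
    \<comment> \<open>\<open>b\<close> is a bad vertex as long as one is left, so the number of bad
      vertices never exceeds the number of groups to come.\<close>
    have "\<exists>b\<in>L'. s1 - 1 \<le> card (L' - bad - {b}) \<and> card (L' \<inter> bad - {b}) \<le> q"
    proof (cases "L' \<inter> bad = {}")
      case True
      have "L' \<noteq> {}" using cL' by auto
      then obtain b where b: "b \<in> L'" by blast
      have "card (L' - bad - {b}) = card (L' - bad) - 1" using b True by (subst card_Diff_singleton) auto
      then have "s1 - 1 \<le> card (L' - bad - {b})" using cL' cg True by simp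
      then show ?thesis using b True by auto
    next
      case False
      then obtain b where b: "b \<in> L'" "b \<in> bad" by blast
      then have "L' - bad - {b} = L' - bad" by auto
      moreover have "card (L' \<inter> bad - {b}) \<le> q" using b h(2) finL' by (subst card_Diff_singleton) auto
      ultimately show ?thesis using b cL' cg h(2) by (intro bexI[of _ b]) auto
    qed
    then obtain b where b: "b \<in> L'" "s1 - 1 \<le> card (L' - bad - {b})" "card (L' \<inter> bad - {b}) \<le> q"
      by blast
    then obtain T where T: "T \<subseteq> L' - bad - {b}" "card T = s1 - 1" by (meson obtain_subset_with_card_n)
    have Tb: "b \<in> L" "T \<subseteq> L - bad" using b T h(1) by auto
    from common_nbrs_good[OF Tb T(2) h(3,4)] obtain Y where Y: "Y \<subseteq> V - X" "card Y = s2"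
      "\<forall>x\<in>insert b T. \<forall>y\<in>Y. {x, y} \<in> E" by blast
    have finT: "finite T" using T(1) finL' by (meson finite_Diff finite_subset)
    have ct: "card (insert b T) = s1"
    proof -
      have "b \<notin> T" using T by auto
      then show ?thesis using finT T(2) s1_ge by simp
    qed
    have sub: "insert b T \<subseteq> L'" using b T by auto
    have "card (L' - insert b T) = s1 * q"
      using sub ct finT h(2) by (subst card_Diff_subset) auto
    moreover have "card ((L' - insert b T) \<inter> bad) \<le> card (L' \<inter> bad - {b})"
      using finL' by (intro card_mono) auto
    ultimately show "\<exists>g\<subseteq>L'. \<exists>Y\<subseteq>V - X. card g = s1 \<and> card Y = s2 \<and> (\<forall>x\<in>g. \<forall>y\<in>Y. {x, y} \<in> E)
        \<and> card (L' - g) = s1 * q \<and> card ((L' - g) \<inter> bad) \<le> q"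
      using sub ct Y b(3) by (intro exI[of _ "insert b T"] conjI exI[of _ Y]) auto
  qed (use L' PV N bq in auto)
  then obtain \<T> where T: "packing (hosts (V, E) B) \<T>" "card \<T> = q" "\<Union>\<T> \<inter> \<Union>\<S> = {}" by blast
  have "card \<S> + card \<T> = t + 1" using T(2) qp by simp
  then show False using packing_extend_false[OF S(1) T(1,3)] by blast
qed

lemma card_L_le_a: "card L \<le> a"
proof (rule ccontr)
  assume "\<not> ?thesis"
  then show False using extension_false[of "{}"] by simp
qed

text \<open>The deficiency of L: every copy of B that meets L in at most s1 - 1 vertices makes up for one
  missing vertex of L, so x + 1 disjoint copies of this kind lead to a contradiction.\<close>

definition x where "x = a - card L"

lemma x_eq: "card L + x + 1 = s1 * (t + 1)"
  using card_L_le_a a_eq by (simp add: x_def)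

lemma x_small: "100 * s * (x + 1) \<le> t"
proof -
  have "s \<le> s ^ 4" using s_pow[of 1 4] by simp
  then have "s * x \<le> s ^ 4 * x" by (rule mult_right_mono) simp
  then have "6400 * (s * x) \<le> t" using first_bounds(2) unfolding x_def[symmetric] mult.assoc by linarith
  then show ?thesis using t_ge1 by (simp add: algebra_simps)
qed

subsection \<open>Vertices with few neighbours among the large-degree vertices\<close>

text \<open>A forbidden graph touching U cannot be completed inside L. These vertices are handled by
  counting: the non-edges between L and a vertex of U outweigh all edges that it has outside L.\<close>

definition U where "U = {v\<in>V - L. s1 * t \<le> 4 * s * card (L - nbr E v)}"

lemma U_sub: "U \<subseteq> V - L" by (auto simp: U_def)

lemma finU: "finite U" using U_sub finV by (meson finite_Diff finite_subset)

lemma U_bound: "s1 * t * card U \<le> 8 * s * M"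
proof -
  have "card U * (s1 * t) \<le> 2 * (4 * s) * M"
    by (rule card_missing_ge[OF finV, where f = "\<lambda>v. L - nbr E v"]) (use LV in \<open>auto simp: U_def\<close>)
  then show ?thesis by (simp add: mult_ac)
qed

text \<open>Fewer than s vertices outside \<open>U\<close>, each missing less than s1 t / (4 s) of
  \<open>L\<close>, miss at most a quarter of s1 t altogether. The deficit x and the set
  \<open>X\<close> are each at most t / 100, so half of s1 t survives.\<close>

lemma common_large:
  assumes Y: "Y \<subseteq> V - L - U" "card Y \<le> s2 + 1" and X: "X \<subseteq> L" "100 * card X \<le> t"
  shows "s1 * t \<le> 2 * card {w\<in>L - X. \<forall>v\<in>Y. {v, w} \<in> E}"
proof -
  let ?A = "{w\<in>L - X. \<forall>v\<in>Y. {v, w} \<in> E}"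
  define D where "D = (\<Union>v\<in>Y. L - nbr E v)"
  have finY: "finite Y" using Y(1) finV by (meson finite_Diff finite_subset)
  have "card D \<le> (\<Sum>v\<in>Y. card (L - nbr E v))" unfolding D_def by (rule card_UN_le[OF finY])
  then have "4 * s * card D \<le> (\<Sum>v\<in>Y. 4 * s * card (L - nbr E v))"
    by (metis mult_le_mono2 sum_distrib_left)
  also have "\<dots> \<le> of_nat (card Y) * (s1 * t)"
    by (rule sum_bounded_above) (use Y(1) in \<open>force simp: U_def\<close>)
  also have "\<dots> \<le> s * (s1 * t)" using Y(2) s_ge(4) by (intro mult_right_mono) auto
  finally have "s * (4 * card D) \<le> s * (s1 * t)" by (simp add: mult_ac)
  then have cD: "4 * card D \<le> s1 * t" using s_ge(1) by simp
  have "L \<subseteq> ?A \<union> (X \<union> D)" by (auto simp: D_def nbr_def)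
  moreover have "finite (?A \<union> (X \<union> D))" using finL X(1) finY by (auto simp: D_def intro: finite_subset)
  ultimately have "card L \<le> card (?A \<union> (X \<union> D))" by (rule card_mono[rotated])
  also have "\<dots> \<le> card ?A + (card X + card D)" by (meson add_left_mono card_Un_le le_trans)
  finally have 1: "card L \<le> card ?A + (card X + card D)" .
  have "1 * (x + 1) \<le> s * (x + 1)" using s_ge by (intro mult_right_mono) auto
  then have "100 * x + 100 \<le> t" using x_small by (simp add: mult.assoc)
  moreover define w where "w = s1 * t"
  moreover have "card L + x + 1 = w + s1" using x_eq by (simp add: w_def)
  moreover have "2 * t \<le> w" using s1_ge by (simp add: w_def)
  ultimately show ?thesis using 1 cD X(2) by linarith
qed

text \<open>Stated for a general \<open>Q\<close> to serve both the stars and the forbidden graphs.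
  By \<open>x_small\<close>, x + 1 completions occupy at most t / 100 vertices of \<open>L\<close>,
  whence the bound on \<open>X\<close>.\<close>

lemma max_special_packing:
  assumes Q: "\<And>S. Q S \<Longrightarrow> S \<noteq> {} \<and> S \<subseteq> V - L"
    and ext: "\<And>S X. Q S \<Longrightarrow> X \<subseteq> L \<Longrightarrow> 100 * card X \<le> t \<Longrightarrow>
      \<exists>T\<subseteq>L - X. card T = s1 - 1 \<and> hosts (V, E) B (S \<union> T)"
  obtains \<S> where "packing Q \<S>" "card \<S> \<le> x" "\<forall>S. Q S \<longrightarrow> S \<inter> \<Union>\<S> \<noteq> {}"
proof -
  have no: "\<not> (packing Q \<S> \<and> card \<S> = x + 1)" for \<S>
  proof
    assume S: "packing Q \<S> \<and> card \<S> = x + 1"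
    have "\<exists>\<T>. packing (hosts (V, E) B) \<T> \<and> card \<T> = card \<S> \<and> card (\<Union>\<T> \<inter> L) \<le> card \<S> * (s1 - 1)"
    proof (rule attach_packing)
      show "finite \<S>" "pairwise disjnt \<S>" using S by (auto simp: packing_def)
      show "S \<inter> L = {}" if "S \<in> \<S>" for S using S Q that by (auto simp: packing_def)
      show "finite L" by (rule finL)
      fix S X assume a: "S \<in> \<S>" "X \<subseteq> L" "card X \<le> card \<S> * (s1 - 1)"
      have "card X \<le> (x + 1) * s" using a(3) S s_ge(3)
        by (metis diff_le_self le_trans mult_le_mono2)
      then have "100 * card X \<le> t" using x_small by (simp add: algebra_simps)
      moreover have "Q S" using S a(1) by (auto simp: packing_def)
      ultimately show "\<exists>T\<subseteq>L - X. card T = s1 - 1 \<and> hosts (V, E) B (S \<union> T)"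
        using ext a(2) by blast
    qed
    then obtain \<T> where T: "packing (hosts (V, E) B) \<T>" "card \<T> = x + 1"
      "card (\<Union>\<T> \<inter> L) \<le> card \<T> * (s1 - 1)" using S by auto
    have "1 * (x + 1) \<le> s * (x + 1)" using s_ge by (intro mult_right_mono) auto
    then have "2 * card \<T> \<le> t" using x_small T(2) by (simp add: mult.assoc)
    moreover have "a + 1 \<le> card \<T> + card L" using T(2) x_eq a_eq by simp
    ultimately show False using extension_false[OF T(1) _ T(3)] by blast
  qed
  have "(\<exists>\<S>. packing Q \<S> \<and> card \<S> = x + 1) \<or>
    (\<exists>\<S>. packing Q \<S> \<and> card \<S> < x + 1 \<and> (\<forall>S. Q S \<longrightarrow> S \<inter> \<Union>\<S> \<noteq> {}))"
    by (rule packing_or_maximal) (use Q in blast)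
  then obtain \<S> where "packing Q \<S>" "card \<S> < x + 1" "\<forall>S. Q S \<longrightarrow> S \<inter> \<Union>\<S> \<noteq> {}"
    using no by blast
  then show ?thesis using that by (metis Suc_eq_plus1 less_Suc_eq_le)
qed

section \<open>Deleting stars and copies of B outside L\<close>

lemma max_copies:
  obtains \<S> where "packing (\<lambda>S. hosts (V, E) B S \<and> S \<subseteq> V - L) \<S>" "card \<S> \<le> x"
    "\<forall>S. hosts (V, E) B S \<and> S \<subseteq> V - L \<longrightarrow> S \<inter> \<Union>\<S> \<noteq> {}"
proof -
  let ?Q = "\<lambda>S. hosts (V, E) B S \<and> S \<subseteq> V - L"
  have no: "\<not> (packing ?Q \<S> \<and> card \<S> = x + 1)" for \<S>
  proof
    assume S: "packing ?Q \<S> \<and> card \<S> = x + 1"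
    then have pk: "packing (hosts (V, E) B) \<S>" using packing_mono by blast
    have "\<Union>\<S> \<inter> L = {}" using S by (auto simp: packing_def)
    then have c0: "card (\<Union>\<S> \<inter> L) \<le> card \<S> * (s1 - 1)" by simp
    have "1 * (x + 1) \<le> s * (x + 1)" using s_ge by (intro mult_right_mono) auto
    then have "2 * card \<S> \<le> t" using x_small S by (simp add: mult.assoc)
    moreover have "a + 1 \<le> card \<S> + card L" using S x_eq a_eq by simp
    ultimately show False using extension_false[OF pk _ c0] by blast
  qed
  have "(\<exists>\<S>. packing ?Q \<S> \<and> card \<S> = x + 1) \<or>
    (\<exists>\<S>. packing ?Q \<S> \<and> card \<S> < x + 1 \<and> (\<forall>S. ?Q S \<longrightarrow> S \<inter> \<Union>\<S> \<noteq> {}))"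
    by (rule packing_or_maximal) (use hosts_nonempty B_nonempty in blast)
  then obtain \<S> where "packing ?Q \<S>" "card \<S> < x + 1" "\<forall>S. ?Q S \<longrightarrow> S \<inter> \<Union>\<S> \<noteq> {}"
    using no by blast
  then show ?thesis using that by (metis Suc_eq_plus1 less_Suc_eq_le)
qed

text \<open>Only the leaves must avoid \<open>U\<close>: in the completion the centre is on the same
  side as the s1 - 1 vertices from \<open>L\<close> and need not be adjacent to them. The resulting
  degree bound thus also covers vertices of \<open>U\<close>.\<close>

definition star where
  "star S \<longleftrightarrow> S \<subseteq> V - L \<and> (\<exists>c Y. S = insert c Y \<and> c \<notin> Y \<and> Y \<inter> U = {} \<and> card Y = s2 \<and> (\<forall>y\<in>Y. {c, y} \<in> E))"

lemma star_card: "star S \<Longrightarrow> card S = s2 + 1"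
proof -
  assume "star S"
  then obtain c Y where S: "S \<subseteq> V - L" "S = insert c Y" "c \<notin> Y" "card Y = s2" by (auto simp: star_def)
  then have "finite Y" using finV by (meson finite_Diff finite_insert finite_subset)
  then show ?thesis using S by simp
qed

lemma star_extend:
  assumes "star S" and X: "X \<subseteq> L" "100 * card X \<le> t"
  shows "\<exists>T\<subseteq>L - X. card T = s1 - 1 \<and> hosts (V, E) B (S \<union> T)"
proof -
  obtain c Y where S: "S \<subseteq> V - L" "S = insert c Y" "c \<notin> Y" "Y \<inter> U = {}" "card Y = s2"
    "\<forall>y\<in>Y. {c, y} \<in> E" using assms(1) by (auto simp: star_def)
  let ?A = "{w\<in>L - X. \<forall>v\<in>Y. {v, w} \<in> E}"
  have YV: "Y \<subseteq> V - L - U" using S by auto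
  have "s1 * t \<le> 2 * card ?A" by (rule common_large[OF YV _ X]) (use S(5) in simp)
  moreover have "s1 * 2 \<le> s1 * t" using t_ge1 s_ge by (intro mult_left_mono) auto
  ultimately have "s1 - 1 \<le> card ?A" by linarith
  then obtain T where T: "T \<subseteq> ?A" "card T = s1 - 1" by (meson obtain_subset_with_card_n)
  have TL: "T \<subseteq> L" using T by auto
  have finT: "finite T" using TL finL by (meson finite_subset)
  have finY: "finite Y" using YV finV by (meson finite_Diff finite_subset)
  have cT: "c \<notin> T" using S TL by auto
  have "hosts (V, E) B (insert c T \<union> Y)"
  proof (rule hosts_complete_bipartite[OF graph parts(1,2,5)])
    show "card (insert c T) = card W1" using cT finT T(2) parts(3) s1_ge by simp
    show "card Y = card W2" using S(5) parts(4) by simp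
    show "insert c T \<inter> Y = {}" using S TL by auto
    show "insert c T \<subseteq> V" "Y \<subseteq> V" using S TL LV by auto
    fix u y assume "u \<in> insert c T" "y \<in> Y"
    then show "{u, y} \<in> E" using S(6) T(1) by (auto simp: insert_commute)
  qed (use finT finY in auto)
  moreover have "insert c T \<union> Y = S \<union> T" using S(2) by auto
  ultimately show ?thesis using T by (intro exI[of _ T]) auto
qed

text \<open>Maximal packings of stars and of copies of B are deleted together. Stars control the
  edges into V - L - U but not those inside \<open>U\<close>; deleting copies makes the latter part
  B-free.\<close>

lemma removal_set:
  obtains R where "R \<subseteq> V - L" "card R \<le> 2 * x * s"
    "\<And>v. v \<in> V - L - R \<Longrightarrow> card (nbr E v \<inter> (V - L - U - R)) \<le> s2"
    "\<And>S. hosts (V, E) B S \<Longrightarrow> \<not> S \<subseteq> U - R"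
proof -
  have st: "S \<noteq> {} \<and> S \<subseteq> V - L" if "star S" for S using that by (auto simp: star_def)
  obtain \<S> where S: "packing star \<S>" "card \<S> \<le> x" "\<forall>S. star S \<longrightarrow> S \<inter> \<Union>\<S> \<noteq> {}"
    by (rule max_special_packing[OF st star_extend])
  obtain \<T> where T: "packing (\<lambda>S. hosts (V, E) B S \<and> S \<subseteq> V - L) \<T>" "card \<T> \<le> x"
    "\<forall>S. hosts (V, E) B S \<and> S \<subseteq> V - L \<longrightarrow> S \<inter> \<Union>\<T> \<noteq> {}" by (rule max_copies)
  let ?R = "\<Union>\<S> \<union> \<Union>\<T>"
  have sub: "?R \<subseteq> V - L" using S(1) T(1) by (auto simp: packing_def star_def)
  have "card (\<Union>\<S>) \<le> card \<S> * s"
    by (rule card_Union_packing_le[OF S(1)]) (use star_card s_ge(4) in auto)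
  moreover have "card (\<Union>\<T>) \<le> card \<T> * s"
    by (rule card_Union_packing_le[OF T(1)]) (auto dest: host_card)
  moreover have "card \<S> * s \<le> x * s" "card \<T> * s \<le> x * s"
    using S(2) T(2) by (auto intro: mult_right_mono)
  ultimately have c: "card ?R \<le> 2 * x * s"
    using card_Un_le[of "\<Union>\<S>" "\<Union>\<T>"] by linarith
  have deg: "card (nbr E v \<inter> (V - L - U - ?R)) \<le> s2" if v: "v \<in> V - L - ?R" for v
  proof (rule ccontr)
    assume "\<not> ?thesis"
    then have "s2 \<le> card (nbr E v \<inter> (V - L - U - ?R))" by simp
    then obtain Y where Y: "Y \<subseteq> nbr E v \<inter> (V - L - U - ?R)" "card Y = s2"
      by (meson obtain_subset_with_card_n)
    have "v \<notin> Y" using Y nbr_subset[OF gV, of v] by auto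
    moreover have "\<forall>y\<in>Y. {v, y} \<in> E" using Y by (auto simp: nbr_def)
    moreover have "Y \<inter> U = {}" "insert v Y \<subseteq> V - L" using Y v by auto
    ultimately have "star (insert v Y)" unfolding star_def using Y(2) by blast
    moreover have "insert v Y \<inter> \<Union>\<S> = {}" using Y v by auto
    ultimately show False using S(3) by blast
  qed
  have "\<not> S \<subseteq> U - ?R" if h: "hosts (V, E) B S" for S
  proof
    assume "S \<subseteq> U - ?R"
    then have "S \<subseteq> V - L" "S \<inter> \<Union>\<T> = {}" using U_sub by auto
    then show False using T(3) h by blast
  qed
  then show ?thesis using that[OF sub c deg] by blast
qed

text \<open>A B-free subset of \<open>U\<close> has at most 2 ex(n, B) / n edges per vertex, while
  each vertex of \<open>U\<close> accounts for s1 t / (8 s) missing pairs. By \<open>ex_le\<close>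
  the former is a tiny fraction of the latter.\<close>

lemma edges_U_bound:
  assumes "\<And>S. hosts (V, E) B S \<Longrightarrow> \<not> S \<subseteq> U - R"
  shows "100 * card (edges_in E (U - R)) \<le> M"
proof -
  let ?e = "card (edges_in E (U - R))"
  have "U - R \<subseteq> V" using U_sub by auto
  then have "?e * n \<le> 2 * card (U - R) * ex_graph n B" using free_part(1)[OF _ assms] by blast
  also have "\<dots> \<le> 2 * card U * ex_graph n B"
    using finU by (intro mult_right_mono mult_left_mono card_mono) auto
  finally have "25600 * s ^ 5 * (?e * n) \<le> 25600 * s ^ 5 * (2 * card U * ex_graph n B)"
    by (rule mult_left_mono) simp
  also have "\<dots> = 2 * card U * (25600 * s ^ 5 * ex_graph n B)" by simp
  also have "\<dots> \<le> 2 * card U * (s1 * t * n)" using ex_le by (rule mult_left_mono) simp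
  finally have "25600 * s ^ 5 * ?e * n \<le> 2 * (s1 * t * card U) * n" by (simp add: mult_ac)
  then have "25600 * s ^ 5 * ?e \<le> 2 * (s1 * t * card U)" using n_pos by simp
  also have "\<dots> \<le> 2 * (8 * s * M)" using U_bound by (rule mult_left_mono) simp
  also have "\<dots> = s * (16 * M)" by simp
  also have "25600 * s ^ 5 * ?e = s * (25600 * s ^ 4 * ?e)"
    by (simp add: power_Suc[symmetric] del: power_Suc)
  finally have "s * (25600 * s ^ 4 * ?e) \<le> s * (16 * M)" .
  then have "25600 * s ^ 4 * ?e \<le> 16 * M" using s_ge by simp
  moreover have "1 * ?e \<le> s ^ 4 * ?e" using s_ge by (intro mult_right_mono) auto
  ultimately show ?thesis by linarith
qed

text \<open>The 2 x s deleted vertices cost x n / 8 edges, less than the 3/4 x n of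
  \<open>missing_le1\<close>, and the edges inside \<open>U\<close> cost M / 100. All other edges
  outside \<open>L\<close> are covered by the degree bound s2.\<close>

lemma M_linear: "M \<le> 2 * s2 * n"
proof -
  obtain R where R: "R \<subseteq> V - L" "card R \<le> 2 * x * s"
    "\<And>v. v \<in> V - L - R \<Longrightarrow> card (nbr E v \<inter> (V - L - U - R)) \<le> s2"
    "\<And>S. hosts (V, E) B S \<Longrightarrow> \<not> S \<subseteq> U - R" by (rule removal_set) blast
  define Z where "Z = V - L - U - R"
  have finR: "finite R" using R(1) finV by (meson finite_Diff finite_subset)
  have "16 * eO \<le> 16 * card (edges_in E (V - L - R)) + 2 * x * n"
    by (rule card_edges_outside_L[OF finR _ R(2)]) (use R(1) in auto)
  moreover have "V - L - R = (U - R) \<union> Z" using U_sub by (auto simp: Z_def)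
  moreover have "card (edges_in E ((U - R) \<union> Z))
      \<le> card (edges_in E (U - R)) + card (edges_in E Z) + card (U - R) * s2"
    by (rule card_edges_in_Un[OF gV]) (use finU R(3) U_sub in \<open>auto simp: Z_def\<close>)
  moreover have "card (edges_in E Z) \<le> card Z * s2"
    by (rule card_edges_in_degree[OF gV]) (use finV R(3) in \<open>auto simp: Z_def\<close>)
  moreover have "card (U - R) * s2 + card Z * s2 \<le> n * s2"
  proof -
    have "card (U - R) + card Z = card ((U - R) \<union> Z)"
      using finU finV by (intro card_Un_disjoint[symmetric]) (auto simp: Z_def)
    also have "\<dots> \<le> card V" using finV U_sub by (intro card_mono) (auto simp: Z_def)
    finally have "card (U - R) + card Z \<le> n" using cardV by simp
    then show ?thesis unfolding add_mult_distrib[symmetric] by (rule mult_right_mono) simp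
  qed
  ultimately have "16 * eO \<le> 16 * card (edges_in E (U - R)) + 16 * (n * s2) + 2 * x * n" by auto
  then have "real (16 * eO) \<le> real (16 * card (edges_in E (U - R)) + 16 * (n * s2) + 2 * x * n)"
    by (rule of_nat_mono)
  then have "real eO \<le> real (card (edges_in E (U - R))) + real n * real s2 + real x * real n / 8" by simp
  moreover have "real (card (edges_in E (U - R))) \<le> real M / 100"
    using of_nat_mono[OF edges_U_bound[OF R(4)], where 'a = real] by simp
  moreover have "0 \<le> real x * real n" "0 \<le> real M" by simp_all
  moreover have "real M + 3 / 4 * (real x * n) \<le> real eO"
    using missing_le1[OF card_L_le_a] unfolding x_def .
  ultimately have "real M \<le> 2 * (real n * real s2)" by linarith
  then have "real M \<le> real (2 * s2 * n)" by (simp add: mult_ac)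
  then show ?thesis by linarith
qed

text \<open>In contrast to stars every vertex must avoid \<open>U\<close>, since the clique that
  completes the copy is joined to all of them.\<close>

definition member where
  "member S \<longleftrightarrow> S \<subseteq> V - L - U \<and> (\<exists>H\<in>fam. hosts (V, E) H S)"

lemma member_card: "member S \<Longrightarrow> card S = s2 + 1"
  using hosts_card fam_graph unfolding member_def by fastforce

text \<open>Here t^2 \<ge> 32 s1 s n meets the linear bound on \<open>M\<close>: at most t / 4
  vertices have more than t / (2 s1) non-neighbours in \<open>A\<close>, and the others are dense
  enough for a greedy clique.\<close>

lemma clique_in_common:
  assumes A: "A \<subseteq> L" "s1 * t \<le> 2 * card A"
  shows "\<exists>T\<subseteq>A. card T = s1 - 1 \<and> (\<forall>u\<in>T. \<forall>y\<in>T. u \<noteq> y \<longrightarrow> {u, y} \<in> E)"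
proof -
  have finA: "finite A" using A(1) finL by (meson finite_subset)
  define D where "D = {v\<in>A. t < 2 * s1 * card (A - nbr E v - {v})}"
  have "card D * t \<le> 2 * (2 * s1) * M"
    by (rule card_missing_ge[OF finV, where f = "\<lambda>v. A - nbr E v - {v}"]) (use A LV in \<open>auto simp: D_def\<close>)
  also have "\<dots> \<le> 2 * (2 * s1) * (2 * s2 * n)" using M_linear by (rule mult_left_mono) simp
  finally have "4 * (card D * t) \<le> 32 * s1 * s2 * n" by (simp add: mult_ac)
  also have "\<dots> \<le> 32 * s1 * s * n" using s_ge(5) by (intro mult_right_mono mult_left_mono) auto
  also have "\<dots> \<le> t ^ 2" by (rule t_sq)
  finally have "4 * card D * t \<le> t * t" by (simp add: power2_eq_square)
  then have cD: "4 * card D \<le> t" using t_pos by simp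
  define A' where "A' = A - D"
  have "card A' = card A - card D" unfolding A'_def using finA by (intro card_Diff_subset) (auto simp: D_def)
  then have cA': "s1 * t \<le> 2 * card A' + 2 * card D" using A(2) by simp
  \<comment> \<open>The additional 1 is for the vertex itself.\<close>
  define d where "d = t div (2 * s1) + 1"
  have "\<exists>T\<subseteq>A'. card T = s1 - 1 \<and> (\<forall>u\<in>T. \<forall>y\<in>T. u \<noteq> y \<longrightarrow> {u, y} \<in> E)"
  proof (rule greedy_clique)
    show "finite A'" using finA by (simp add: A'_def)
    show "{v} \<notin> E" for v using gV by (auto simp: is_graph_def)
    fix v assume v: "v \<in> A'"
    have "card {w\<in>A'. {v, w} \<notin> E} \<le> card (insert v (A - nbr E v - {v}))"
      using finA by (intro card_mono) (auto simp: A'_def nbr_def)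
    also have "\<dots> \<le> card (A - nbr E v - {v}) + 1"
      by (metis add.commute card_Un_le insert_is_Un is_singletonI is_singleton_altdef)
    also have "card (A - nbr E v - {v}) \<le> t div (2 * s1)"
    proof -
      have "2 * s1 * card (A - nbr E v - {v}) \<le> t" using v by (auto simp: A'_def D_def)
      then show ?thesis using s1_ge by (simp add: less_eq_div_iff_mult_less_eq mult_ac)
    qed
    finally show "card {w\<in>A'. {v, w} \<notin> E} \<le> d" by (simp add: d_def)
  next
    have "(s1 - 1) * d \<le> s1 * d" by simp
    also have "\<dots> = s1 * (t div (2 * s1)) + s1" by (simp add: d_def)
    finally have "2 * ((s1 - 1) * d) \<le> 2 * s1 * (t div (2 * s1)) + 2 * s1" by simp
    also have "\<dots> \<le> t + 2 * s1" by simp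
    finally have 1: "2 * ((s1 - 1) * d) \<le> t + 2 * s1" .
    define w where "w = s1 * t"
    have "2 * t \<le> w" using s1_ge by (simp add: w_def)
    then show "(s1 - 1) * d < card A' + d"
      using 1 cA'[folded w_def] cD s_ge(2) t_ge1 t_pos by linarith
  qed
  then show ?thesis by (auto simp: A'_def)
qed

lemma member_extend:
  assumes "member S" and X: "X \<subseteq> L" "100 * card X \<le> t"
  shows "\<exists>T\<subseteq>L - X. card T = s1 - 1 \<and> hosts (V, E) B (S \<union> T)"
proof -
  obtain H where H: "H \<in> fam" "hosts (V, E) H S" using assms(1) by (auto simp: member_def)
  obtain S0 where S0: "H = (S0, {e\<in>snd B. e \<subseteq> S0})" "S0 \<subseteq> fst B" "card S0 = s2 + 1"
    using H(1) by (auto simp: induced_family_def)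
  obtain f where f: "embedding f (S0, {e\<in>snd B. e \<subseteq> S0}) (V, E)" "f ` S0 = S"
    using H(2) S0(1) by (auto simp: hosts_def)
  have SV: "S \<subseteq> V - L - U" using assms(1) by (simp add: member_def)
  let ?A = "{w\<in>L - X. \<forall>v\<in>S. {v, w} \<in> E}"
  have "s1 * t \<le> 2 * card ?A"
    by (rule common_large[OF SV _ X]) (use member_card[OF assms(1)] in simp)
  then obtain T where T: "T \<subseteq> ?A" "card T = s1 - 1" "\<forall>u\<in>T. \<forall>y\<in>T. u \<noteq> y \<longrightarrow> {u, y} \<in> E"
    using clique_in_common[of ?A] by auto
  have TL: "T \<subseteq> L" using T by auto
  have "hosts (V, E) B (f ` S0 \<union> T)"
  proof (rule hosts_extend[OF graph S0(2) f(1)])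
    show "finite T" using TL finL by (meson finite_subset)
    show "card T = card (fst B - S0)"
      using S0 finite_B card_B T(2) by (subst card_Diff_subset) (auto intro: finite_subset)
    show "T \<subseteq> V" using TL LV by auto
    show "T \<inter> f ` S0 = {}" using TL SV f(2) by auto
    show "{u, y} \<in> E" if "u \<in> T" "y \<in> T" "u \<noteq> y" for u y using T(3) that by blast
    show "{u, y} \<in> E" if "u \<in> T" "y \<in> f ` S0" for u y
      using T(1) that f(2) by (auto simp: insert_commute)
  qed
  then show ?thesis using T f(2) by (intro exI[of _ T]) auto
qed

section \<open>The final count of edges\<close>

lemma choose_gap: "real ((n - a) choose 2) + 3 / 4 * (real x * n) \<le> real ((n - card L) choose 2)"
proof -
  have r: "real (n - card L) = real n - card L" "real (n - a) = real n - card L - x"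
    using a_small card_L_le_a by (auto simp: x_def)
  have "2 * (real n - card L) - x - 1 \<ge> 3 / 2 * n" using a_small card_L_le_a by (simp add: x_def)
  then have "real x * (3 / 2 * n) \<le> real x * (2 * (real n - card L) - x - 1)"
    by (rule mult_left_mono) simp
  then show ?thesis unfolding real_choose_two r by (simp add: field_simps)
qed

text \<open>Ensures that the part left in the final count still has s2 + 1 vertices, as
  \<open>card_le_ex_family\<close> demands.\<close>

lemma card_U_small: "card U \<le> s * t"
proof -
  have "s1 * t * card U \<le> 8 * s * M" by (rule U_bound)
  also have "\<dots> \<le> 8 * s * (2 * s2 * n)" using M_linear by (rule mult_left_mono) simp
  finally have "s1 * t * card U \<le> 8 * s * (2 * s2 * n)" .
  then have "2 * s1 * (s1 * t * card U) \<le> 2 * s1 * (8 * s * (2 * s2 * n))" by (rule mult_left_mono) simp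
  also have "\<dots> = s2 * (32 * s1 * s * n)" by simp
  also have "\<dots> \<le> s2 * t ^ 2" using t_sq by (rule mult_left_mono) simp
  finally have "(2 * s1 * s1 * card U) * t \<le> (s2 * t) * t" by (simp add: power2_eq_square mult_ac)
  then have "2 * s1 * s1 * card U \<le> s2 * t" using t_pos by simp
  moreover have "1 * card U \<le> 2 * s1 * s1 * card U" using s1_ge by (intro mult_right_mono) auto
  moreover have "s2 * t \<le> s * t" using s_ge by simp
  ultimately show ?thesis by linarith
qed

text \<open>Pays for the edges leaving \<open>U\<close>: s2 per vertex, against s1 t / (8 s) missing
  pairs per vertex.\<close>

lemma U_cross_small: "100 * (card U * s2) \<le> M"
proof -
  have "s2 * 1 \<le> s * s1" using s_ge s1_ge by (intro mult_mono) auto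
  then have "800 * s * s2 \<le> 800 * s * (s * s1)" by (intro mult_left_mono) auto
  also have "\<dots> = s1 * (800 * s\<^sup>2)" by (simp add: power2_eq_square)
  also have "\<dots> \<le> s1 * t" using t_ge[of 2] by (intro mult_left_mono) auto
  finally have "800 * s * s2 * card U \<le> s1 * t * card U" by (rule mult_right_mono) simp
  also have "\<dots> \<le> 8 * s * M" by (rule U_bound)
  finally have "s * (800 * (card U * s2)) \<le> s * (8 * M)" by (simp add: mult_ac)
  then show ?thesis using s_ge by (simp add: mult_ac)
qed

text \<open>The losses are M / 50 for the edges at \<open>U\<close> and x n / 4 for the 4 x s
  deleted vertices; the savings are M and, by \<open>choose_gap\<close>, 3/4 x n.\<close>

lemma edge_bound: "card E + ((n - a) choose 2) \<le> (n choose 2) + ex_family (n - a) fam"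
proof -
  obtain R where R: "R \<subseteq> V - L" "card R \<le> 2 * x * s"
    "\<And>v. v \<in> V - L - R \<Longrightarrow> card (nbr E v \<inter> (V - L - U - R)) \<le> s2"
    "\<And>S. hosts (V, E) B S \<Longrightarrow> \<not> S \<subseteq> U - R" by (rule removal_set) blast
  have me: "S \<noteq> {} \<and> S \<subseteq> V - L" if "member S" for S
    using member_card[OF that] that by (auto simp: member_def)
  obtain \<S> where S: "packing member \<S>" "card \<S> \<le> x" "\<forall>S. member S \<longrightarrow> S \<inter> \<Union>\<S> \<noteq> {}"
    by (rule max_special_packing[OF me member_extend])
  have cVL: "card (V - L) = n - card L" using LV finL cardV by (simp add: card_Diff_subset)
  then have "x \<le> card (V - L)" using a_small by (simp add: x_def)
  \<comment> \<open>Deleting x further arbitrary vertices brings the remaining part down to at most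
    n - a vertices, the size at which the extremal number is taken.\<close>
  then obtain R4 where R4: "R4 \<subseteq> V - L" "card R4 = x" by (meson obtain_subset_with_card_n)
  define R' where "R' = R \<union> \<Union>\<S> \<union> R4"
  have R'V: "R' \<subseteq> V - L" using R(1) S(1) R4 by (auto simp: R'_def packing_def member_def)
  have finR': "finite R'" using R'V finV by (meson finite_Diff finite_subset)
  have cR': "card R' \<le> 4 * x * s"
  proof -
    have "card (\<Union>\<S>) \<le> card \<S> * s"
      by (rule card_Union_packing_le[OF S(1)]) (use member_card s_ge(4) in auto)
    moreover have "card \<S> * s \<le> x * s" using S(2) by (rule mult_right_mono) simp
    moreover have "x * 1 \<le> x * s" using s_ge by (intro mult_left_mono) auto
    moreover have "card R' \<le> card R + card (\<Union>\<S>) + card R4"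
      unfolding R'_def by (meson add_mono_thms_linordered_semiring(3) card_Un_le le_trans)
    ultimately show ?thesis using R(2) R4(2) by linarith
  qed
  define Z where "Z = V - L - U - R'"
  have finZ: "finite Z" using finV by (simp add: Z_def)
  have ZR: "Z \<subseteq> V - L - U - R" by (auto simp: Z_def R'_def)
  have e1: "16 * eO \<le> 16 * card (edges_in E (V - L - R')) + 4 * x * n"
    by (rule card_edges_outside_L[OF finR' _ cR']) (use R'V in auto)
  have split: "V - L - R' = (U - R') \<union> Z" using U_sub by (auto simp: Z_def)
  have "card (edges_in E ((U - R') \<union> Z))
      \<le> card (edges_in E (U - R')) + card (edges_in E Z) + card (U - R') * s2"
  proof (rule card_edges_in_Un[OF gV])
    fix v assume "v \<in> U - R'"
    then have "v \<in> V - L - R" using U_sub by (auto simp: R'_def)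
    then have "card (nbr E v \<inter> (V - L - U - R)) \<le> s2" by (rule R(3))
    moreover have "card (nbr E v \<inter> Z) \<le> card (nbr E v \<inter> (V - L - U - R))"
      using ZR finite_nbr[OF gV] by (intro card_mono) auto
    ultimately show "card (nbr E v \<inter> Z) \<le> s2" by linarith
  qed (use finU in auto)
  moreover have "100 * (card (U - R') * s2) \<le> M"
  proof -
    have "100 * (card (U - R') * s2) \<le> 100 * (card U * s2)"
      using finU by (intro mult_left_mono mult_right_mono card_mono) auto
    then show ?thesis using U_cross_small by (rule le_trans)
  qed
  moreover have "100 * card (edges_in E (U - R')) \<le> M"
  proof (rule edges_U_bound)
    fix S assume "hosts (V, E) B S"
    then show "\<not> S \<subseteq> U - R'" using R(4) by (auto simp: R'_def)
  qed
  moreover have "card (edges_in E Z) \<le> ex_family (n - a) fam"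
  proof (rule card_le_ex_family)
    show "is_graph (Z, edges_in E Z)" using gV finZ by (auto simp: is_graph_def edges_in_def)
    have "card Z \<le> card (V - L - R4)" using finV by (intro card_mono) (auto simp: Z_def R'_def)
    also have "\<dots> = n - card L - x"
      using R4 cVL finV by (subst card_Diff_subset) (auto intro: finite_subset)
    finally show "card Z \<le> n - a" using card_L_le_a by (simp add: x_def)
    show "\<not> contains_copy (Z, edges_in E Z) H" if H: "H \<in> fam" for H
    proof
      assume "contains_copy (Z, edges_in E Z) H"
      then obtain f where f: "embedding f H (Z, edges_in E Z)" by (auto simp: contains_copy_def)
      have fZ: "f ` fst H \<subseteq> Z" using f by (auto simp: embedding_def)
      have "embedding f H (V, E)" using f by (auto simp: embedding_def edges_in_def Z_def)
      then have "member (f ` fst H)" using H fZ by (auto simp: member_def hosts_def Z_def)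
      then have "f ` fst H \<inter> \<Union>\<S> \<noteq> {}" using S(3) by blast
      then show False using fZ by (auto simp: Z_def R'_def)
    qed
    have "V \<subseteq> Z \<union> (L \<union> (U \<union> R'))" by (auto simp: Z_def)
    moreover have "finite (Z \<union> (L \<union> (U \<union> R')))" using finZ finL finU finR' by simp
    ultimately have "n \<le> card (Z \<union> (L \<union> (U \<union> R')))" using card_mono cardV by metis
    also have "\<dots> \<le> card Z + (card L + (card U + card R'))"
      by (meson add_left_mono card_Un_le le_trans)
    finally have n: "n \<le> card Z + (card L + (card U + card R'))" .
    define w where "w = s * t"
    have "t \<le> w" using s_ge by (simp add: w_def)
    moreover have "256 * w \<le> n" "card U \<le> w" using n_ge_t(2) card_U_small by (simp_all add: w_def mult_ac)
    moreover have "card R' \<le> t" using cR' x_small by (simp add: algebra_simps)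
    moreover have "s2 + 1 \<le> t" using s_ge(4) t_ge1 by linarith
    moreover have "4 * card L \<le> n" using a_small by simp
    ultimately have "s2 + 1 \<le> card Z" using n t_pos by linarith
    then show "is_graph H \<and> card (fst H) \<le> card Z" if "H \<in> fam" for H using fam_graph[OF that] by simp
  qed
  ultimately have "100 * card (edges_in E (V - L - R')) \<le> 2 * M + 100 * ex_family (n - a) fam"
    unfolding split by linarith
  then have "100 * (16 * eO) \<le> 16 * (2 * M) + 1600 * ex_family (n - a) fam + 400 * (x * n)"
    using e1 by linarith
  then have "real (100 * (16 * eO)) \<le> real (16 * (2 * M) + 1600 * ex_family (n - a) fam + 400 * (x * n))"
    by (rule of_nat_mono)
  then have e2: "1600 * real eO \<le> 32 * real M + 1600 * real (ex_family (n - a) fam) + 400 * (real x * real n)"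
    by simp
  have "real (card E + M + ((n - card L) choose 2)) = real ((n choose 2) + eO)"
    using card_edges_missing[OF gV LV] unfolding cVL cardV by (rule arg_cong)
  then have "real (card E) + real M + real ((n - card L) choose 2) = real (n choose 2) + real eO"
    by simp
  moreover have "0 \<le> real x * real n" "0 \<le> real M" by simp_all
  ultimately have "real (card E) + real ((n - a) choose 2) \<le> real (n choose 2) + real (ex_family (n - a) fam)"
    using choose_gap e2 by linarith
  then show ?thesis by linarith
qed

end

section \<open>The extremal number\<close>

lemma (in covered_bipartite) ex_disjoint_eq:
  assumes s: "s = s1 + s2" and C: "C = 32 * s * s1" and a: "a + 1 = s1 * (t + 1)"
    and t_le: "2048 * s1 * s ^ 3 * t \<le> n"
    and t_sq: "32 * s1 * s * n \<le> t ^ 2"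
    and ex_le: "25600 * s ^ 5 * ex_graph n B \<le> s1 * t * n"
    and t_large: "2000000 * s ^ 6 \<le> t"
    and n_large: "C * 2 ^ C * s2 < n"
    and a_le: "a \<le> n"
  shows "ex_disjoint n (t + 1) B + ((n - a) choose 2) = (n choose 2) + ex_family (n - a) fam"
proof -
  have "n - a + s1 * (t + 1) = n + 1" using a_le a by simp
  then obtain E0 where E0: "is_graph ({0..<n}, E0)" "\<not> contains_disjoint_copies ({0..<n}, E0) (t + 1) B"
    "card E0 + ((n - a) choose 2) = (n choose 2) + ex_family (n - a) fam"
    by (rule join_construction)
  have "card E0 \<le> ex_disjoint n (t + 1) B"
    unfolding ex_disjoint_def using E0(1,2) by (rule ex_prop_ge)
  moreover obtain E where E: "is_graph ({0..<n}, E)" "\<not> contains_disjoint_copies ({0..<n}, E) (t + 1) B"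
    "card E = ex_disjoint n (t + 1) B"
    unfolding ex_disjoint_def by (rule ex_prop_attained[OF E0(1), of "\<lambda>G. \<not> contains_disjoint_copies G (t + 1) B"])
      (use E0(2) in auto)
  moreover have "card E + ((n - a) choose 2) \<le> (n choose 2) + ex_family (n - a) fam"
  \<comment> \<open>A graph with fewer edges satisfies the bound trivially; otherwise it meets the
    density assumption of the locale.\<close>
  proof (cases "n choose 2 \<le> card E + ((n - a) choose 2)")
    case True
    interpret dense_packing_free B s1 s2 W1 W2 n t s C a E
      by unfold_locales (use assms E True in auto)
    show ?thesis by (rule edge_bound)
  qed simp
  ultimately show ?thesis using E0(3) by linarith
qed

theorem theorem1p12:
  fixes B :: "'a set \<times> 'a set set" and s1 s2 :: nat
  assumes "2 \<le> s1" and "s1 \<le> s2"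
    and "is_graph B" and "bipartite_by B s1 s2" and "graph_connected B"
    and "cover_number B = s1"
  shows "\<exists>n0::nat. \<forall>n\<ge>n0. \<forall>t::nat.
     max (sqrt (32 * s1 * (s1 + s2) * n))
         (12800 * exp 1 * (s1 + s2) ^ 5 / s1 *
            (real (ex_graph n B) / (real n - 1) + 576 * exp 1 * s1 * (s1 + s2) ^ 2)) \<le> real t
     \<and> real t \<le> real n / (1024 * exp 1 * s1 * (s1 + s2) ^ 3)
     \<longrightarrow> int (ex_disjoint n (t + 1) B) =
           int (n choose 2) - int ((n - s1 * (t + 1) + 1) choose 2)
           + int (ex_family (n - s1 * (t + 1) + 1) (induced_family B (s2 + 1)))"
proof -
  obtain W1 W2 where W: "W1 \<inter> W2 = {}" "W1 \<union> W2 = fst B" "card W1 = s1" "card W2 = s2"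
    "\<forall>e\<in>snd B. e \<inter> W1 \<noteq> {} \<and> e \<inter> W2 \<noteq> {}"
    using assms(4) unfolding bipartite_by_def by blast
  interpret covered_bipartite B s1 s2 W1 W2
    by unfold_locales (use assms W in auto)
  define s where "s = s1 + s2"
  define C where "C = 32 * s * s1"
  \<comment> \<open>The summands serve the pigeonhole step, the positivity of n - 1, and t \<ge>
    2000000 s^6, which follows from t^2 \<ge> n.\<close>
  define n0 where "n0 = C * 2 ^ C * s2 + 2 + (2000000 * s ^ 6)\<^sup>2"
  have s_ge: "4 \<le> s" using assms(1,2) by (simp add: s_def)
  have e2: "2 \<le> exp (1::real)" using exp_ge_add_one_self[of 1] by simp
  show ?thesis
    unfolding s_def[symmetric]
  proof (intro exI[of _ n0] allI impI, elim conjE)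
    fix n t :: nat
    assume n: "n0 \<le> n"
      and lo: "max (sqrt (32 * s1 * s * n)) (12800 * exp 1 * s ^ 5 / s1 *
            (real (ex_graph n B) / (real n - 1) + 576 * exp 1 * s1 * s ^ 2)) \<le> real t"
      and hi: "real t \<le> real n / (1024 * exp 1 * s1 * s ^ 3)"
    have n2: "2 \<le> n" and n_large: "C * 2 ^ C * s2 < n" and n_sq: "(2000000 * s ^ 6)\<^sup>2 \<le> n"
      using n unfolding n0_def by linarith+
    have sq: "sqrt (32 * s1 * s * n) \<le> real t" using lo by simp
    have "real (32 * s1 * s * n) \<le> (real t)\<^sup>2" using sqrt_le_D[OF sq] by simp
    then have t_sq: "32 * s1 * s * n \<le> t ^ 2" by (metis of_nat_le_iff of_nat_power)
    have "1 * n \<le> 32 * s1 * s * n" using assms(1) s_ge by (intro mult_right_mono) auto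
    then have "(2000000 * s ^ 6)\<^sup>2 \<le> t ^ 2" using n_sq t_sq by linarith
    then have t_large: "2000000 * s ^ 6 \<le> t" by (rule power2_le_imp_le) simp
    have pos: "0 < real s1" "0 < real s" using assms(1) s_ge by auto
    have t_le: "2048 * s1 * s ^ 3 * t \<le> n"
    proof -
      have d: "0 < 1024 * exp 1 * real s1 * real s ^ 3" using pos by simp
      have "real t * (1024 * exp 1 * real s1 * real s ^ 3) \<le> real n"
        using hi by (simp add: pos_le_divide_eq[OF d])
      moreover have "2 * (real t * 1024 * real s1 * real s ^ 3) \<le> exp 1 * (real t * 1024 * real s1 * real s ^ 3)"
        using e2 by (rule mult_right_mono) simp
      ultimately have "real (2048 * s1 * s ^ 3 * t) \<le> real n" by (simp add: mult_ac)
      then show ?thesis by linarith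
    qed
    have ex_le: "25600 * s ^ 5 * ex_graph n B \<le> s1 * t * n"
    proof -
      let ?c = "12800 * exp 1 * real s ^ 5 / real s1" and ?q = "real (ex_graph n B) / (real n - 1)"
      have q0: "0 \<le> ?q" using n2 by simp
      have c0: "0 \<le> ?c" by simp
      have "?c * ?q \<le> ?c * (?q + 576 * exp 1 * s1 * s ^ 2)" by (rule mult_left_mono[OF _ c0]) simp
      also have "\<dots> \<le> real t" using lo by simp
      finally have 1: "?c * ?q \<le> real t" .
      have "25600 * real s ^ 5 / real s1 \<le> ?c"
        using e2 pos by (intro divide_right_mono) (auto intro: mult_right_mono)
      then have "25600 * real s ^ 5 / real s1 * ?q \<le> ?c * ?q" by (rule mult_right_mono[OF _ q0])
      then have "25600 * real s ^ 5 / real s1 * ?q \<le> real t" using 1 by linarith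
      then have "25600 * real s ^ 5 * real (ex_graph n B) \<le> real t * (real s1 * (real n - 1))"
        using pos n2 by (simp add: field_simps)
      also have "\<dots> \<le> real t * (real s1 * real n)" by (intro mult_left_mono) auto
      finally have "real (25600 * s ^ 5 * ex_graph n B) \<le> real (s1 * t * n)" by (simp add: mult_ac)
      then show ?thesis by linarith
    qed
    define a where "a = s1 * (t + 1) - 1"
    have st: "1 \<le> s1 * (t + 1)" using assms(1) by simp
    \<comment> \<open>With this the truncated subtraction n - s1 (t + 1) in the statement is a true
      one.\<close>
    have an: "s1 * (t + 1) \<le> n"
    proof -
      have "1 \<le> s ^ 6" using s_ge by simp
      then have "1 \<le> t" using t_large by linarith
      then have "s1 * (t + 1) \<le> s1 * (2 * t)" by (intro mult_left_mono) auto
      also have "\<dots> \<le> 2048 * s1 * s ^ 3 * t"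
      proof -
        have "1 * (2 * s1 * t) \<le> (1024 * s ^ 3) * (2 * s1 * t)" using s_ge by (intro mult_right_mono) auto
        then show ?thesis by (simp add: mult_ac)
      qed
      finally show ?thesis using t_le by linarith
    qed
    have a: "a + 1 = s1 * (t + 1)" "a \<le> n" "n - s1 * (t + 1) + 1 = n - a"
      using st an unfolding a_def by linarith+
    show "int (ex_disjoint n (t + 1) B) =
           int (n choose 2) - int ((n - s1 * (t + 1) + 1) choose 2)
           + int (ex_family (n - s1 * (t + 1) + 1) (induced_family B (s2 + 1)))"
      using ex_disjoint_eq[OF s_def C_def a(1) t_le t_sq ex_le t_large n_large a(2)] unfolding a(3) by linarith
  qed
qed

end
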